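(* Let $\alpha\colon\mathbb{N}\to\mathbb{C}$ be a sequence such that the multiplicative Hankel operator $M(\alpha)$ is bounded on $\ell^2(\mathbb{N})$. Then there exists a sequence $\beta\colon\mathbb{N}\to\mathbb{C}$ such that $N(\beta)=M(\beta)$ is a compact multiplicative Hankel operator on $\ell^2(\mathbb{N})$ and $$\|M(\alpha)-N(\beta)\|_{\mathcal{B}(\ell^2(\mathbb{N}))}=\inf\left\{\|M(\alpha)-K\|_{\mathcal{B}(\ell^2(\mathbb{N}))}\,:\,K\colon\ell^2(\mathbb{N})\to\ell^2(\mathbb{N})\text{ compact}\right\}.$$ Moreover, unless $M(\alpha)$ is compact, such a minimizing compact multiplicative Hankel operator $N(\beta)$ is not unique.
   Context: For a sequence $\alpha\colon\mathbb{N}\to\mathbb{C}$, the multiplicative Hankel operator (Helson matrix) $M(\alpha)$ is defined by the form $\langle M(\alpha)a,b\rangle_{\ell^2(\mathbb{N})}=\sum_{n,m=1}^\infty a(n)\overline{b(m)}\alpha(nm)$ for finitely supported sequences $a,b$; it is called bounded if $|\langle M(\alpha)a,b\rangle|\le C\|a\|_{\ell^2}\|b\|_{\ell^2}$ for all finitely supported $a,b$ and some $C>0$, in which case it extends to a bounded operator on $\ell^2(\mathbb{N})$ with matrix $\{\alpha(nm)\}_{n,m\ge1}$. $\mathcal{B}(\ell^2(\mathbb{N}))$ denotes the bounded operators with the operator norm. *)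

theory Defs
  imports "HOL-Analysis.Analysis"
begin

text \<open>Sequences on \<open>\<nat> = {1,2,...}\<close> are encoded as functions \<open>nat \<Rightarrow> complex\<close>;
  elements of \<open>\<ell>\<^sup>2(\<nat>)\<close> are required to vanish at the dummy index 0.\<close>

definition l2 :: "(nat \<Rightarrow> complex) set" where
  "l2 = {a. a 0 = 0 \<and> summable (\<lambda>n. (cmod (a n))\<^sup>2)}"

definition l2norm :: "(nat \<Rightarrow> complex) \<Rightarrow> real" where
  "l2norm a = sqrt (\<Sum>n. (cmod (a n))\<^sup>2)"

definition hankel_bounded :: "(nat \<Rightarrow> complex) \<Rightarrow> bool" where
  "hankel_bounded \<alpha> \<longleftrightarrow> (\<exists>C>0. \<forall>(a::nat \<Rightarrow> complex) (b::nat \<Rightarrow> complex) (N::nat).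
     cmod (\<Sum>n=1..N. \<Sum>m=1..N. a n * cnj (b m) * \<alpha> (n * m))
       \<le> C * sqrt (\<Sum>n=1..N. (cmod (a n))\<^sup>2) * sqrt (\<Sum>m=1..N. (cmod (b m))\<^sup>2))"

definition hankel_op :: "(nat \<Rightarrow> complex) \<Rightarrow> (nat \<Rightarrow> complex) \<Rightarrow> (nat \<Rightarrow> complex)" where
  "hankel_op \<alpha> a = (\<lambda>m. if m = 0 then 0 else (\<Sum>n. a (Suc n) * \<alpha> (Suc n * m)))"

definition bounded_op :: "((nat \<Rightarrow> complex) \<Rightarrow> (nat \<Rightarrow> complex)) \<Rightarrow> bool" where
  "bounded_op T \<longleftrightarrow> (\<forall>a\<in>l2. T a \<in> l2)
     \<and> (\<forall>a\<in>l2. \<forall>b\<in>l2. \<forall>c::complex. T (\<lambda>n. a n + c * b n) = (\<lambda>n. T a n + c * T b n))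
     \<and> (\<exists>C. \<forall>a\<in>l2. l2norm (T a) \<le> C * l2norm a)"

definition op_norm :: "((nat \<Rightarrow> complex) \<Rightarrow> (nat \<Rightarrow> complex)) \<Rightarrow> real" where
  "op_norm T = Sup {l2norm (T a) | a. a \<in> l2 \<and> l2norm a \<le> 1}"

definition compact_op :: "((nat \<Rightarrow> complex) \<Rightarrow> (nat \<Rightarrow> complex)) \<Rightarrow> bool" where
  "compact_op K \<longleftrightarrow> bounded_op K \<and>
     (\<forall>x::nat \<Rightarrow> nat \<Rightarrow> complex. (\<forall>k. x k \<in> l2) \<and> (\<exists>B. \<forall>k. l2norm (x k) \<le> B) \<longrightarrow>
        (\<exists>r y. strict_mono r \<and> y \<in> l2 \<and>
           (\<lambda>k. l2norm (\<lambda>n. K (x (r k)) n - y n)) \<longlonglongrightarrow> 0))"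

definition op_diff :: "((nat \<Rightarrow> complex) \<Rightarrow> (nat \<Rightarrow> complex)) \<Rightarrow> ((nat \<Rightarrow> complex) \<Rightarrow> (nat \<Rightarrow> complex))
    \<Rightarrow> (nat \<Rightarrow> complex) \<Rightarrow> (nat \<Rightarrow> complex)" where
  "op_diff S T = (\<lambda>a n. S a n - T a n)"

definition dist_compact :: "((nat \<Rightarrow> complex) \<Rightarrow> (nat \<Rightarrow> complex)) \<Rightarrow> real" where
  "dist_compact T = Inf {op_norm (op_diff T K) | K. compact_op K}"

end

theory Submission
  imports Defs "HOL-Complex_Analysis.Great_Picard"
begin

text \<open>
  Multiplying \<open>\<alpha>\<close> by the completely multiplicative function \<open>n \<mapsto> n\<^bsup>-r\<^esup>\<close> conjugates \<open>M(\<alpha>)\<close> by the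
  compact diagonal operator with entries \<open>n\<^bsup>-r\<^esup>\<close>. For small \<open>r > 0\<close> this yields compact multiplicative
  Hankel operators that tend to \<open>M(\<alpha>)\<close> strongly, together with their adjoints, as \<open>r \<rightarrow> 0\<close>. Following
  Axler, Berg, Jewell and Shields, a best approximation is found as an infinite convex combination of
  these, with symbol \<open>\<beta>(n) = \<alpha>(n) \<Sum>\<^sub>j c\<^sub>j n\<^bsup>-r\<^sub>j\<^esup>\<close>. The weights \<open>c\<^sub>j\<close> are geometric with small first
  term, so that the distance \<open>e\<close> of \<open>M(\<alpha>)\<close> to the compacts exceeds \<open>(c\<^sub>0 + ... + c\<^sub>j\<^sub>-\<^sub>1) e + 2 c\<^sub>j \<parallel>M(\<alpha>)\<parallel>\<close>
  for all \<open>j\<close>; if \<open>r\<^sub>j\<close> is chosen small enough depending on its predecessors, the norms of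
  the partial sums of \<open>M(\<alpha>) - M(\<beta>)\<close> never reach \<open>e\<close>. All \<open>r\<^sub>j\<close> may be taken below any given bound,
  which makes \<open>\<beta>\<close> pointwise as close to \<open>\<alpha>\<close> as desired; were the minimizer unique, it would
  be \<open>\<alpha>\<close> itself.
\<close>

subsection \<open>Bilinear forms of multiplicative Hankel matrices\<close>

text \<open>Bilinear, without the conjugate of the inner product, so that the form is symmetric in
  its two arguments. The index sets are explicit: restricting a vector to a region means shrinking
  \<open>X\<close> or \<open>Y\<close>.\<close>

definition hform :: "(nat \<Rightarrow> complex) \<Rightarrow> nat set \<Rightarrow> nat set \<Rightarrow> (nat \<Rightarrow> complex) \<Rightarrow> (nat \<Rightarrow> complex) \<Rightarrow> complex"
  where "hform \<gamma> X Y a b = (\<Sum>n\<in>X. \<Sum>m\<in>Y. a n * b m * \<gamma> (n * m))"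

abbreviation vnorm :: "nat set \<Rightarrow> (nat \<Rightarrow> complex) \<Rightarrow> real"
  where "vnorm X a \<equiv> L2_set (\<lambda>n. cmod (a n)) X"

text \<open>\<open>C\<close> bounds the norm of the matrix block with rows in \<open>A\<close> and
  columns in \<open>B\<close>. Testing on finite sets keeps all estimates free of convergence
  questions.\<close>

definition hform_le :: "(nat \<Rightarrow> complex) \<Rightarrow> nat set \<Rightarrow> nat set \<Rightarrow> real \<Rightarrow> bool"
  where "hform_le \<gamma> A B C \<longleftrightarrow> (\<forall>X Y a b. finite X \<longrightarrow> finite Y \<longrightarrow> X \<subseteq> A \<longrightarrow> Y \<subseteq> B \<longrightarrow>
    cmod (hform \<gamma> X Y a b) \<le> C * vnorm X a * vnorm Y b)"

abbreviation pos :: "nat set" where "pos \<equiv> {0<..}"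

lemma hform_leI:
  assumes "\<And>X Y a b. \<lbrakk>finite X; finite Y; X \<subseteq> A; Y \<subseteq> B\<rbrakk>
    \<Longrightarrow> cmod (hform \<gamma> X Y a b) \<le> C * vnorm X a * vnorm Y b"
  shows "hform_le \<gamma> A B C"
  using assms by (simp add: hform_le_def)

lemma hform_leD:
  assumes "hform_le \<gamma> A B C" "finite X" "finite Y" "X \<subseteq> A" "Y \<subseteq> B"
  shows "cmod (hform \<gamma> X Y a b) \<le> C * vnorm X a * vnorm Y b"
  using assms by (simp add: hform_le_def)

lemma hform_le_subset:
  assumes "hform_le \<gamma> A B C" "A' \<subseteq> A" "B' \<subseteq> B"
  shows "hform_le \<gamma> A' B' C"
  using assms unfolding hform_le_def by (meson subset_trans)

lemma hform_le_weaken: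
  assumes "hform_le \<gamma> A B C" "C \<le> C'"
  shows "hform_le \<gamma> A B C'"
proof (rule hform_leI)
  fix X Y a b assume "finite X" "finite Y" "X \<subseteq> A" "Y \<subseteq> B"
  then have "cmod (hform \<gamma> X Y a b) \<le> C * vnorm X a * vnorm Y b"
    by (rule hform_leD[OF assms(1)])
  also have "\<dots> \<le> C' * vnorm X a * vnorm Y b"
    by (intro mult_right_mono assms(2)) auto
  finally show "cmod (hform \<gamma> X Y a b) \<le> C' * vnorm X a * vnorm Y b" .
qed

lemma hform_swap: "hform \<gamma> X Y a b = hform \<gamma> Y X b a"
  unfolding hform_def by (subst sum.swap) (simp add: mult.commute)

text \<open>The entry at (n, m) depends only on the product nm, so the matrix is symmetric.
  Estimates for columns, and hence for adjoints, follow from those for rows.\<close>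

lemma hform_le_swap:
  assumes "hform_le \<gamma> A B C"
  shows "hform_le \<gamma> B A C"
proof (rule hform_leI)
  fix X Y a b assume "finite X" "finite Y" "X \<subseteq> B" "Y \<subseteq> A"
  then show "cmod (hform \<gamma> X Y a b) \<le> C * vnorm X a * vnorm Y b"
    using hform_leD[OF assms, of Y X b a] by (simp add: hform_swap[of \<gamma> X] mult_ac)
qed

lemma hform_add_symbol:
  "hform (\<lambda>n. \<gamma> n + \<delta> n) X Y a b = hform \<gamma> X Y a b + hform \<delta> X Y a b"
  unfolding hform_def by (simp add: distrib_left sum.distrib)

lemma hform_scale_symbol:
  "hform (\<lambda>n. c * \<gamma> n) X Y a b = c * hform \<gamma> X Y a b"
  unfolding hform_def by (simp add: sum_distrib_left mult_ac)

lemma hform_le_add: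
  assumes "hform_le \<gamma> A B C" "hform_le \<delta> A B D"
  shows "hform_le (\<lambda>n. \<gamma> n + \<delta> n) A B (C + D)"
proof (rule hform_leI)
  fix X Y a b assume "finite X" "finite Y" "X \<subseteq> A" "Y \<subseteq> B"
  then show "cmod (hform (\<lambda>n. \<gamma> n + \<delta> n) X Y a b) \<le> (C + D) * vnorm X a * vnorm Y b"
    using hform_leD[OF assms(1), of X Y a b] hform_leD[OF assms(2), of X Y a b]
      norm_triangle_ineq[of "hform \<gamma> X Y a b" "hform \<delta> X Y a b"]
    by (simp add: hform_add_symbol algebra_simps)
qed

lemma hform_le_scale:
  assumes "hform_le \<gamma> A B C"
  shows "hform_le (\<lambda>n. c * \<gamma> n) A B (cmod c * C)"
  using assms unfolding hform_le_def
  by (simp add: hform_scale_symbol norm_mult mult.assoc mult_left_mono)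

text \<open>Each form is a finite sum, hence continuous under pointwise convergence of the symbols.
  This is how norm bounds reach the infinite convex combination.\<close>

lemma hform_le_limit:
  assumes "\<And>j. hform_le (\<gamma> j) A B C" and "\<And>n. (\<lambda>j. \<gamma> j n) \<longlonglongrightarrow> \<delta> n"
  shows "hform_le \<delta> A B C"
proof (rule hform_leI)
  fix X Y a b assume XY: "finite X" "finite Y" "X \<subseteq> A" "Y \<subseteq> B"
  have "(\<lambda>j. hform (\<gamma> j) X Y a b) \<longlonglongrightarrow> hform \<delta> X Y a b"
    unfolding hform_def by (intro tendsto_intros assms(2))
  then have "(\<lambda>j. cmod (hform (\<gamma> j) X Y a b)) \<longlonglongrightarrow> cmod (hform \<delta> X Y a b)"
    by (rule tendsto_norm)
  then show "cmod (hform \<delta> X Y a b) \<le> C * vnorm X a * vnorm Y b"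
    by (rule LIMSEQ_le_const2) (use hform_leD[OF assms(1) XY] in blast)
qed

lemma hform_union_left:
  assumes "finite X" "finite X'" "X \<inter> X' = {}"
  shows "hform \<gamma> (X \<union> X') Y a b = hform \<gamma> X Y a b + hform \<gamma> X' Y a b"
  unfolding hform_def using assms by (simp add: sum.union_disjoint)

lemma hform_union_right:
  assumes "finite Y" "finite Y'" "Y \<inter> Y' = {}"
  shows "hform \<gamma> X (Y \<union> Y') a b = hform \<gamma> X Y a b + hform \<gamma> X Y' a b"
  by (simp add: hform_swap[of \<gamma> X] hform_union_left[OF assms])

lemma vnorm_mono_set: "finite Y \<Longrightarrow> X \<subseteq> Y \<Longrightarrow> vnorm X a \<le> vnorm Y a"
  unfolding L2_set_def by (auto intro: sum_mono2)

lemma vnorm_sq: "(vnorm X a)\<^sup>2 = (\<Sum>n\<in>X. (cmod (a n))\<^sup>2)"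
  unfolding L2_set_def by (simp add: sum_nonneg)

lemma cauchy_schwarz_vnorm: "cmod (\<Sum>n\<in>X. a n * b n) \<le> vnorm X a * vnorm X b"
proof -
  have "cmod (\<Sum>n\<in>X. a n * b n) \<le> (\<Sum>n\<in>X. \<bar>cmod (a n)\<bar> * \<bar>cmod (b n)\<bar>)"
    by (rule order_trans[OF norm_sum]) (simp add: norm_mult)
  also have "\<dots> \<le> vnorm X a * vnorm X b" by (rule L2_set_mult_ineq)
  finally show ?thesis .
qed

lemma vnorm_union_le:
  assumes "finite X" "finite X'" "X \<inter> X' = {}"
  shows "vnorm (X \<union> X') a \<le> vnorm X a + vnorm X' a"
  unfolding L2_set_def using assms
  by (simp add: sum.union_disjoint sqrt_add_le_add_sqrt sum_nonneg)

text \<open>Cauchy-Schwarz in the column index for each row, with every single \<bar>a n\<bar>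
  bounded by the norm of \<open>a\<close>. The bound is crude, but enough for finitely many rows
  that are all small.\<close>

lemma hform_le_rows:
  assumes A: "finite A" and R: "\<And>n Y. \<lbrakk>n \<in> A; finite Y; Y \<subseteq> B\<rbrakk> \<Longrightarrow> vnorm Y (\<lambda>m. \<gamma> (n * m)) \<le> R n"
  shows "hform_le \<gamma> A B (\<Sum>n\<in>A. R n)"
proof (rule hform_leI)
  fix X Y a b assume XY: "finite X" "finite Y" "X \<subseteq> A" "Y \<subseteq> B"
  have R0: "0 \<le> R n" if "n \<in> A" for n
    using R[OF that, of "{}"] by simp
  have "cmod (hform \<gamma> X Y a b) \<le> (\<Sum>n\<in>X. cmod (\<Sum>m\<in>Y. a n * b m * \<gamma> (n * m)))"
    unfolding hform_def by (rule norm_sum)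
  also have "\<dots> \<le> (\<Sum>n\<in>X. R n * (vnorm X a * vnorm Y b))"
  proof (rule sum_mono)
    fix n assume n: "n \<in> X"
    have "cmod (\<Sum>m\<in>Y. a n * b m * \<gamma> (n * m)) = cmod (a n) * cmod (\<Sum>m\<in>Y. b m * \<gamma> (n * m))"
      by (simp add: mult.assoc norm_mult flip: sum_distrib_left)
    also have "\<dots> \<le> vnorm X a * (vnorm Y b * R n)"
      using n XY cauchy_schwarz_vnorm[of b "\<lambda>m. \<gamma> (n * m)" Y] R[of n Y]
      by (intro mult_mono order_trans[OF cauchy_schwarz_vnorm] mult_left_mono)
        (auto intro: member_le_L2_set[where f = "\<lambda>n. cmod (a n)"])
    finally show "cmod (\<Sum>m\<in>Y. a n * b m * \<gamma> (n * m)) \<le> R n * (vnorm X a * vnorm Y b)"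
      by (simp add: mult_ac)
  qed
  also have "\<dots> \<le> (\<Sum>n\<in>A. R n * (vnorm X a * vnorm Y b))"
    using XY A R0 by (intro sum_mono2) auto
  finally show "cmod (hform \<gamma> X Y a b) \<le> (\<Sum>n\<in>A. R n) * vnorm X a * vnorm Y b"
    by (simp add: sum_distrib_right mult.assoc)
qed

section \<open>Square-summable rows: separation of head and tail\<close>

text \<open>Testing the form on the unit vector at \<open>n\<close> and the conjugate of the row
  gives v^2 \<le> C v for the norm v of the row.\<close>

lemma row_vnorm_le:
  assumes h: "hform_le \<gamma> pos pos C" and n: "n > 0" and Y: "finite Y" "Y \<subseteq> pos"
  shows "vnorm Y (\<lambda>m. \<gamma> (n * m)) \<le> C"
proof -
  let ?v = "vnorm Y (\<lambda>m. \<gamma> (n * m))"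
  have "hform \<gamma> {n} Y (\<lambda>_. 1) (\<lambda>m. cnj (\<gamma> (n * m))) = of_real (?v\<^sup>2)"
    unfolding vnorm_sq hform_def of_real_sum
    by (simp add: mult.commute[of "cnj _"] flip: complex_norm_square)
  with hform_leD[OF h, of "{n}" Y "\<lambda>_. 1" "\<lambda>m. cnj (\<gamma> (n * m))"] n Y
  have "?v\<^sup>2 \<le> C * ?v" by (simp add: norm_power)
  moreover have "0 \<le> C" using hform_leD[OF h, of "{1}" "{1}" "\<lambda>_. 1" "\<lambda>_. 1"]
    by (simp add: order_trans[OF norm_ge_zero])
  ultimately show ?thesis
    by (cases "?v = 0") (auto simp: power2_eq_square mult_le_cancel_right)
qed

lemma hform_le_nonneg: "hform_le \<gamma> pos pos C \<Longrightarrow> 0 \<le> C"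
  using row_vnorm_le[of \<gamma> C 1 "{}"] by simp

lemma row_summable:
  assumes h: "hform_le \<gamma> pos pos C" and n: "n > 0"
  shows "summable (\<lambda>m. (cmod (\<gamma> (n * Suc m)))\<^sup>2)"
proof (rule summableI_nonneg_bounded)
  fix N
  have "(\<Sum>m<N. (cmod (\<gamma> (n * Suc m)))\<^sup>2) = (vnorm (Suc ` {..<N}) (\<lambda>m. \<gamma> (n * m)))\<^sup>2"
    unfolding vnorm_sq by (simp add: sum.reindex)
  also have "\<dots> \<le> C\<^sup>2"
    by (intro power_mono row_vnorm_le[OF h n]) auto
  finally show "(\<Sum>m<N. (cmod (\<gamma> (n * Suc m)))\<^sup>2) \<le> C\<^sup>2" .
qed simp

lemma row_tail_small:
  assumes h: "hform_le \<gamma> pos pos C" and n: "n > 0" and \<eta>: "\<eta> > 0"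
  shows "\<forall>\<^sub>F j in sequentially. \<forall>Y. finite Y \<longrightarrow> Y \<subseteq> {j<..} \<longrightarrow> vnorm Y (\<lambda>m. \<gamma> (n * m)) \<le> \<eta>"
proof -
  let ?f = "\<lambda>m. (cmod (\<gamma> (n * Suc m)))\<^sup>2"
  obtain M where M: "\<And>k l. k \<ge> M \<Longrightarrow> norm (sum ?f {k..<l}) < \<eta>\<^sup>2"
    using row_summable[OF h n] \<eta> unfolding summable_Cauchy by (meson zero_less_power)
  have "vnorm Y (\<lambda>m. \<gamma> (n * m)) \<le> \<eta>" if j: "j \<ge> M" and Y: "finite Y" "Y \<subseteq> {j<..}" for j Y
  proof -
    obtain l where l: "Y \<subseteq> {..<l}" using finite_nat_iff_bounded Y(1) by auto
    have "Y \<subseteq> Suc ` {j..<l}"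
    proof
      fix y assume "y \<in> Y"
      then have "j < y" "y < l" using Y l by auto
      then have "y = Suc (y - 1)" "y - 1 \<in> {j..<l}" by auto
      then show "y \<in> Suc ` {j..<l}" by blast
    qed
    then have "(vnorm Y (\<lambda>m. \<gamma> (n * m)))\<^sup>2 \<le> (\<Sum>m\<in>Suc ` {j..<l}. (cmod (\<gamma> (n * m)))\<^sup>2)"
      unfolding vnorm_sq by (intro sum_mono2) auto
    also have "\<dots> = sum ?f {j..<l}" by (subst sum.reindex) auto
    also have "\<dots> \<le> \<eta>\<^sup>2" using M[OF j, of l] by (simp add: sum_nonneg)
    finally show ?thesis using \<eta> by (simp add: power2_le_iff_abs_le)
  qed
  then show ?thesis unfolding eventually_sequentially by blast
qed

text \<open>Finitely many square-summable rows have a common index \<open>j\<close> beyond which all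
  are small; each of the \<open>i\<close> rows gets the share \<eta>/(i+1). This separates the
  regions below and above a band.\<close>

lemma hform_le_head_tail:
  assumes h: "hform_le \<gamma> pos pos C" and \<eta>: "\<eta> > 0"
  shows "\<exists>j>i. hform_le \<gamma> {1..i} {j<..} \<eta>"
proof -
  define \<theta> where "\<theta> = \<eta> / (real i + 1)"
  have \<theta>: "\<theta> > 0" using \<eta> by (simp add: \<theta>_def)
  have "\<forall>\<^sub>F j in sequentially. \<forall>n\<in>{1..i}. \<forall>Y. finite Y \<longrightarrow> Y \<subseteq> {j<..} \<longrightarrow> vnorm Y (\<lambda>m. \<gamma> (n * m)) \<le> \<theta>"
    by (intro eventually_ball_finite ballI row_tail_small[OF h _ \<theta>]) auto
  then have "\<forall>\<^sub>F j in sequentially. j > i \<and> (\<forall>n\<in>{1..i}. \<forall>Y. finite Y \<longrightarrow> Y \<subseteq> {j<..} \<longrightarrow> vnorm Y (\<lambda>m. \<gamma> (n * m)) \<le> \<theta>)"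
    by (intro eventually_conj eventually_gt_at_top)
  then obtain j where j: "j > i" "\<forall>n\<in>{1..i}. \<forall>Y. finite Y \<longrightarrow> Y \<subseteq> {j<..} \<longrightarrow> vnorm Y (\<lambda>m. \<gamma> (n * m)) \<le> \<theta>"
    unfolding eventually_sequentially by blast
  have "hform_le \<gamma> {1..i} {j<..} (\<Sum>n\<in>{1..i}. \<theta>)"
    by (rule hform_le_rows) (use j in auto)
  moreover have "(\<Sum>n\<in>{1..i}. \<theta>) \<le> \<eta>" using \<eta> by (simp add: \<theta>_def field_simps)
  ultimately show ?thesis using j(1) hform_le_weaken by blast
qed

text \<open>Dominated convergence in each of finitely many rows: far columns are controlled by the
  tail of \<alpha> uniformly in \<open>k\<close>, and the finitely many near entries tend to 0. It
  is the quantitative form of strong convergence to 0.\<close>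

lemma hform_le_head_vanishing:
  assumes h: "hform_le \<alpha> pos pos C"
    and dom: "\<And>k n. n > 0 \<Longrightarrow> cmod (\<tau> k n) \<le> cmod (\<alpha> n)"
    and lim: "\<And>n. n > 0 \<Longrightarrow> (\<lambda>k. \<tau> k n) \<longlonglongrightarrow> 0"
    and \<eta>: "\<eta> > 0"
  shows "\<forall>\<^sub>F k in sequentially. hform_le (\<tau> k) {1..i} pos \<eta>"
proof -
  define \<theta> where "\<theta> = \<eta> / (real i + 1)"
  have \<theta>: "\<theta> > 0" using \<eta> by (simp add: \<theta>_def)
  have row: "\<forall>\<^sub>F k in sequentially. \<forall>Y. finite Y \<longrightarrow> Y \<subseteq> pos \<longrightarrow> vnorm Y (\<lambda>m. \<tau> k (n * m)) \<le> \<theta>"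
    if n: "n > 0" for n
  proof -
    obtain j where j: "\<And>Y. finite Y \<Longrightarrow> Y \<subseteq> {j<..} \<Longrightarrow> vnorm Y (\<lambda>m. \<alpha> (n * m)) \<le> \<theta> / 2"
      using row_tail_small[OF h n, of "\<theta> / 2"] \<theta> unfolding eventually_sequentially by auto
    have "(\<lambda>k. \<Sum>m\<in>{1..j}. cmod (\<tau> k (n * m))) \<longlonglongrightarrow> (\<Sum>m\<in>{1..j}. cmod 0)"
      using n by (intro tendsto_intros lim) auto
    then have "\<forall>\<^sub>F k in sequentially. (\<Sum>m\<in>{1..j}. cmod (\<tau> k (n * m))) < \<theta> / 2"
      using \<theta> by (intro order_tendstoD(2)) auto
    then show ?thesis
    proof (rule eventually_mono, intro allI impI)
      fix k Y assume k: "(\<Sum>m\<in>{1..j}. cmod (\<tau> k (n * m))) < \<theta> / 2" and Y: "finite Y" "Y \<subseteq> pos"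
      let ?t = "\<lambda>m. \<tau> k (n * m)"
      have "vnorm Y ?t = vnorm (Y \<inter> {..j} \<union> Y \<inter> {j<..}) ?t"
        by (rule arg_cong[where f = "\<lambda>Z. vnorm Z ?t"]) auto
      also have "\<dots> \<le> vnorm (Y \<inter> {..j}) ?t + vnorm (Y \<inter> {j<..}) ?t"
        using Y by (intro vnorm_union_le) auto
      also have "vnorm (Y \<inter> {..j}) ?t \<le> vnorm {1..j} ?t"
        using Y by (intro vnorm_mono_set) auto
      also have "vnorm {1..j} ?t \<le> (\<Sum>m\<in>{1..j}. cmod (?t m))"
        by (rule L2_set_le_sum) simp
      also have "\<dots> \<le> \<theta> / 2" using k by simp
      also have "vnorm (Y \<inter> {j<..}) ?t \<le> vnorm (Y \<inter> {j<..}) (\<lambda>m. \<alpha> (n * m))"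
        using n Y by (intro L2_set_mono dom) auto
      also have "\<dots> \<le> \<theta> / 2" using Y by (intro j) auto
      finally show "vnorm Y ?t \<le> \<theta>" by simp
    qed
  qed
  have "\<forall>\<^sub>F k in sequentially. \<forall>n\<in>{1..i}. \<forall>Y. finite Y \<longrightarrow> Y \<subseteq> pos \<longrightarrow> vnorm Y (\<lambda>m. \<tau> k (n * m)) \<le> \<theta>"
    by (intro eventually_ball_finite ballI row) auto
  then show ?thesis
  proof (rule eventually_mono)
    fix k assume "\<forall>n\<in>{1..i}. \<forall>Y. finite Y \<longrightarrow> Y \<subseteq> pos \<longrightarrow> vnorm Y (\<lambda>m. \<tau> k (n * m)) \<le> \<theta>"
    then have "hform_le (\<tau> k) {1..i} pos (\<Sum>n\<in>{1..i}. \<theta>)"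
      by (intro hform_le_rows) auto
    moreover have "(\<Sum>n\<in>{1..i}. \<theta>) \<le> \<eta>" using \<eta> by (simp add: \<theta>_def field_simps)
    ultimately show "hform_le (\<tau> k) {1..i} pos \<eta>" by (rule hform_le_weaken)
  qed
qed

section \<open>Splitting off a light band\<close>

text \<open>Index 1 is below the band, \<open>b\<close> is the band, 2 is above it. The last two
  terms collect everything that meets the band; the rows below it stay in one piece because \<tau>
  is small on them as a whole.\<close>

lemma hform_cross_decomposition:
  assumes "finite X1" "finite Xb" "finite X2" "finite Y1" "finite Yb" "finite Y2"
    and "X1 \<inter> Xb = {}" "X1 \<inter> X2 = {}" "Xb \<inter> X2 = {}"
    and "Y1 \<inter> Yb = {}" "Y1 \<inter> Y2 = {}" "Yb \<inter> Y2 = {}"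
  shows "hform \<gamma> (X1 \<union> X2 \<union> Xb) (Y1 \<union> Y2 \<union> Yb) a b =
    hform \<gamma> X1 (Y1 \<union> Y2) a b + hform \<gamma> X2 Y1 a b + hform \<gamma> X2 Y2 a b
    + hform \<gamma> (X1 \<union> X2) Yb a b + hform \<gamma> Xb (Y1 \<union> Y2 \<union> Yb) a b"
proof -
  have "(X1 \<union> X2) \<inter> Xb = {}" "(Y1 \<union> Y2) \<inter> Yb = {}" using assms by auto
  then show ?thesis using assms by (simp add: hform_union_left hform_union_right)
qed

text \<open>Pigeonhole: the \<open>J\<close> bands are disjoint, so the sum over them of p^2 y^2 +
  x^2 q^2 is at most 2 x^2 y^2, and some band is at most the average. Weighting each mass by the
  other norm selects one band for both vectors without dividing by a norm that may vanish.\<close>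

lemma exists_light_band:
  fixes N :: "nat \<Rightarrow> nat" and J :: nat
  assumes N: "strict_mono N" and J: "J > 0" and X: "finite X" and Y: "finite Y"
  shows "\<exists>i<J. vnorm (X \<inter> {N i<..N (Suc i)}) a * vnorm Y b \<le> sqrt (2 / J) * (vnorm X a * vnorm Y b) \<and>
    vnorm X a * vnorm (Y \<inter> {N i<..N (Suc i)}) b \<le> sqrt (2 / J) * (vnorm X a * vnorm Y b)"
proof -
  define x y where "x = vnorm X a" and "y = vnorm Y b"
  define p q where "p i = vnorm (X \<inter> {N i<..N (Suc i)}) a" and "q i = vnorm (Y \<inter> {N i<..N (Suc i)}) b" for i
  have xy: "x \<ge> 0" "y \<ge> 0" by (simp_all add: x_def y_def)
  have bands: "(\<Sum>i<J. (vnorm (Z \<inter> {N i<..N (Suc i)}) c)\<^sup>2) \<le> (vnorm Z c)\<^sup>2" if Z: "finite Z" for Z c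
  proof -
    have disj: "(Z \<inter> {N i<..N (Suc i)}) \<inter> (Z \<inter> {N j<..N (Suc j)}) = {}" if "i \<noteq> j" for i j
    proof -
      have "N (Suc i) \<le> N j \<or> N (Suc j) \<le> N i"
        using that by (simp add: strict_mono_less_eq[OF N]) linarith
      then show ?thesis by auto
    qed
    have "(\<Sum>i<J. (vnorm (Z \<inter> {N i<..N (Suc i)}) c)\<^sup>2) = (\<Sum>n\<in>(\<Union>i<J. Z \<inter> {N i<..N (Suc i)}). (cmod (c n))\<^sup>2)"
      unfolding vnorm_sq using disj Z by (subst sum.UNION_disjoint) auto
    also have "\<dots> \<le> (vnorm Z c)\<^sup>2"
      unfolding vnorm_sq using Z by (intro sum_mono2) auto
    finally show ?thesis .
  qed
  have "\<exists>i<J. (p i)\<^sup>2 * y\<^sup>2 + x\<^sup>2 * (q i)\<^sup>2 \<le> 2 / J * (x\<^sup>2 * y\<^sup>2)"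
  proof (rule ccontr)
    assume "\<not> ?thesis"
    then have "(\<Sum>i<J. 2 / J * (x\<^sup>2 * y\<^sup>2)) < (\<Sum>i<J. (p i)\<^sup>2 * y\<^sup>2 + x\<^sup>2 * (q i)\<^sup>2)"
      using J by (intro sum_strict_mono) (auto simp: not_le)
    also have "\<dots> = (\<Sum>i<J. (p i)\<^sup>2) * y\<^sup>2 + x\<^sup>2 * (\<Sum>i<J. (q i)\<^sup>2)"
      by (simp add: sum.distrib sum_distrib_left sum_distrib_right)
    also have "\<dots> \<le> x\<^sup>2 * y\<^sup>2 + x\<^sup>2 * y\<^sup>2"
      using bands[OF X, of a] bands[OF Y, of b] unfolding p_def q_def x_def y_def
      by (intro add_mono mult_left_mono mult_right_mono) auto
    finally show False using J by simp
  qed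
  then obtain i where i: "i < J" "(p i)\<^sup>2 * y\<^sup>2 + x\<^sup>2 * (q i)\<^sup>2 \<le> 2 / J * (x\<^sup>2 * y\<^sup>2)" by blast
  have sq: "(sqrt (2 / J) * (x * y))\<^sup>2 = 2 / J * (x\<^sup>2 * y\<^sup>2)"
    by (simp add: power_mult_distrib)
  have "p i * y \<le> sqrt (2 / J) * (x * y)"
  proof (rule power2_le_imp_le)
    have "0 \<le> x\<^sup>2 * (q i)\<^sup>2" by simp
    then show "(p i * y)\<^sup>2 \<le> (sqrt (2 / J) * (x * y))\<^sup>2"
      using i(2) unfolding sq power_mult_distrib[of "p i"] by linarith
  qed (use xy in auto)
  moreover have "x * q i \<le> sqrt (2 / J) * (x * y)"
  proof (rule power2_le_imp_le)
    have "0 \<le> (p i)\<^sup>2 * y\<^sup>2" by simp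
    then show "(x * q i)\<^sup>2 \<le> (sqrt (2 / J) * (x * y))\<^sup>2"
      using i(2) unfolding sq power_mult_distrib[of x "q i"] by linarith
  qed (use xy in auto)
  ultimately show ?thesis using i(1) unfolding p_def q_def x_def y_def by blast
qed

text \<open>Cauchy-Schwarz in the plane for the pairs of block norms. It is the reason why a
  block-diagonal form has the larger of the two block norms, and not their sum, as its norm.\<close>

lemma two_block_vnorm_le:
  assumes "finite X" "X1 \<subseteq> X" "X2 \<subseteq> X" "X1 \<inter> X2 = {}"
    and "finite Y" "Y1 \<subseteq> Y" "Y2 \<subseteq> Y" "Y1 \<inter> Y2 = {}"
  shows "vnorm X1 a * vnorm Y1 b + vnorm X2 a * vnorm Y2 b \<le> vnorm X a * vnorm Y b"
proof -
  have part: "(vnorm Z1 c)\<^sup>2 + (vnorm Z2 c)\<^sup>2 \<le> (vnorm Z c)\<^sup>2"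
    if "finite Z" "Z1 \<subseteq> Z" "Z2 \<subseteq> Z" "Z1 \<inter> Z2 = {}" for Z Z1 Z2 :: "nat set" and c
  proof -
    have "finite Z1" "finite Z2" using that by (auto intro: finite_subset)
    then have "(vnorm Z1 c)\<^sup>2 + (vnorm Z2 c)\<^sup>2 = (\<Sum>n\<in>Z1 \<union> Z2. (cmod (c n))\<^sup>2)"
      unfolding vnorm_sq using that by (simp add: sum.union_disjoint)
    also have "\<dots> \<le> (vnorm Z c)\<^sup>2"
      unfolding vnorm_sq using that by (intro sum_mono2) auto
    finally show ?thesis .
  qed
  let ?x1 = "vnorm X1 a" and ?x2 = "vnorm X2 a" and ?y1 = "vnorm Y1 b" and ?y2 = "vnorm Y2 b"
  have "0 \<le> (?x1 * ?y2 - ?x2 * ?y1)\<^sup>2" by simp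
  then have "(?x1 * ?y1 + ?x2 * ?y2)\<^sup>2 \<le> (?x1\<^sup>2 + ?x2\<^sup>2) * (?y1\<^sup>2 + ?y2\<^sup>2)"
    by (simp add: power2_eq_square algebra_simps)
  also have "\<dots> \<le> (vnorm X a)\<^sup>2 * (vnorm Y b)\<^sup>2"
    using assms by (intro mult_mono part) auto
  finally show ?thesis
    by (intro power2_le_imp_le[of "_ + _"]) (auto simp: power_mult_distrib)
qed

text \<open>The key estimate. A vector has little mass in one of many widely separated bands.
  Below such a band \<open>\<tau> k\<close> is negligible, above it \<open>\<sigma>\<close> only contributes its tail norm, and
  the two regions hardly interact; so the norms of the two parts combine by a maximum instead of a sum.\<close>

lemma perturbation_norm_le_max:
  assumes \<sigma>: "hform_le \<sigma> pos pos d"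
    and tail: "\<And>\<delta>. \<delta> > 0 \<Longrightarrow> \<exists>k. hform_le \<sigma> {k<..} {k<..} (s + \<delta>)"
    and \<tau>: "\<And>k. hform_le (\<tau> k) pos pos G"
    and head: "\<And>i \<eta>. \<eta> > 0 \<Longrightarrow> \<forall>\<^sub>F k in sequentially. hform_le (\<tau> k) {1..i} pos \<eta>"
    and g: "g > 0"
  shows "\<forall>\<^sub>F k in sequentially. hform_le (\<lambda>n. \<sigma> n + \<tau> k n) pos pos (max d (s + G) + g)"
proof -
  \<comment> \<open>Seven portions of \<eta> will be spent: six error terms and the excess of the
    tail norm of \<sigma> over \<open>s\<close>.\<close>
  define \<eta> where "\<eta> = g / 8"
  have \<eta>: "\<eta> > 0" using g by (simp add: \<eta>_def)
  have dG: "d \<ge> 0" "G \<ge> 0" using hform_le_nonneg \<sigma> \<tau> by auto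
  obtain k0 where k0: "hform_le \<sigma> {k0<..} {k0<..} (s + \<eta>)" using tail[OF \<eta>] by blast
  \<comment> \<open>Band \<open>i\<close> will be \<open>{N i<..N (Suc i)}\<close>. Each band is so
    long that \<sigma> hardly connects what lies below it with what lies above it, and everything
    above it lies in the tail region of \<sigma>.\<close>
  have "\<exists>N. \<forall>i. N i \<ge> k0 \<and> (N (Suc i) > N i \<and> hform_le \<sigma> {1..N i} {N (Suc i)<..} \<eta>)"
  proof (rule dependent_nat_choice)
    show "\<exists>x. k0 \<le> x" by blast
    fix x n :: nat assume "k0 \<le> x"
    then show "\<exists>y. k0 \<le> y \<and> (x < y \<and> hform_le \<sigma> {1..x} {y<..} \<eta>)"
      using hform_le_head_tail[OF \<sigma> \<eta>, of x] by (meson less_imp_le order_trans)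
  qed
  then obtain N where N: "\<And>i. N i \<ge> k0" "\<And>i. N (Suc i) > N i"
      "\<And>i. hform_le \<sigma> {1..N i} {N (Suc i)<..} \<eta>" by blast
  have Nm: "strict_mono N" using N(2) by (simp add: strict_mono_Suc_iff)
  \<comment> \<open>With this many bands, the lightest one costs at most \<eta> even against the
    crude total norm \<open>d + G\<close>.\<close>
  obtain J :: nat where J: "J > 0" "(d + G) * sqrt (2 / J) \<le> \<eta>"
  proof -
    have "(\<lambda>J. (d + G) * sqrt (2 * inverse (real J))) \<longlonglongrightarrow> (d + G) * sqrt (2 * 0)"
      by (intro tendsto_intros lim_inverse_n)
    then have "\<forall>\<^sub>F J in sequentially. (d + G) * sqrt (2 * inverse (real J)) < \<eta>"
      using \<eta> by (intro order_tendstoD(2)) auto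
    then have "\<forall>\<^sub>F J in sequentially. (d + G) * sqrt (2 * inverse (real J)) < \<eta> \<and> J > 0"
      by (intro eventually_conj eventually_gt_at_top)
    then obtain J where "(d + G) * sqrt (2 * inverse (real J)) < \<eta>" "J > 0"
      unfolding eventually_sequentially by blast
    then show ?thesis using that[of J] by (simp add: divide_inverse)
  qed
  \<comment> \<open>The light band depends on the vectors, but \<open>N J\<close> lies above all
    \<open>J\<close> candidates, so \<open>k\<close> can be fixed before the vectors are
    given.\<close>
  show ?thesis using head[OF \<eta>, of "N J"]
  proof (rule eventually_mono)
    fix k assume k: "hform_le (\<tau> k) {1..N J} pos \<eta>"
    let ?h = "hform (\<lambda>n. \<sigma> n + \<tau> k n)"
    show "hform_le (\<lambda>n. \<sigma> n + \<tau> k n) pos pos (max d (s + G) + g)"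
    proof (rule hform_leI)
      fix X Y a b assume XY: "finite X" "finite Y" "X \<subseteq> pos" "Y \<subseteq> pos"
      define x y where "x = vnorm X a" and "y = vnorm Y b"
      have xy: "x \<ge> 0" "y \<ge> 0" by (simp_all add: x_def y_def)
      obtain i where i: "i < J" "vnorm (X \<inter> {N i<..N (Suc i)}) a * y \<le> sqrt (2 / J) * (x * y)"
        "x * vnorm (Y \<inter> {N i<..N (Suc i)}) b \<le> sqrt (2 / J) * (x * y)"
        using exists_light_band[OF Nm J(1) XY(1,2), of a b] unfolding x_def y_def by blast
      define X1 Xb X2 where "X1 = X \<inter> {..N i}" and "Xb = X \<inter> {N i<..N (Suc i)}" and "X2 = X \<inter> {N (Suc i)<..}"
      define Y1 Yb Y2 where "Y1 = Y \<inter> {..N i}" and "Yb = Y \<inter> {N i<..N (Suc i)}" and "Y2 = Y \<inter> {N (Suc i)<..}"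
      note defs = X1_def Xb_def X2_def Y1_def Yb_def Y2_def
      have fin: "finite X1" "finite Xb" "finite X2" "finite Y1" "finite Yb" "finite Y2"
        using XY by (auto simp: defs)
      have sub: "X1 \<subseteq> X" "Xb \<subseteq> X" "X2 \<subseteq> X" "Y1 \<subseteq> Y" "Yb \<subseteq> Y" "Y2 \<subseteq> Y" by (auto simp: defs)
      have split: "X1 \<union> X2 \<union> Xb = X" "Y1 \<union> Y2 \<union> Yb = Y" using N(2)[of i] by (auto simp: defs)
      have disj: "X1 \<inter> Xb = {}" "X1 \<inter> X2 = {}" "Xb \<inter> X2 = {}" "Y1 \<inter> Yb = {}" "Y1 \<inter> Y2 = {}" "Yb \<inter> Y2 = {}"
        using N(2)[of i] by (auto simp: defs)
      have le: "vnorm X1 a \<le> x" "vnorm X2 a \<le> x" "vnorm (X1 \<union> X2) a \<le> x" "vnorm Y1 b \<le> y" "vnorm Y2 b \<le> y"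
          "vnorm (Y1 \<union> Y2) b \<le> y"
        unfolding x_def y_def using XY sub by (auto intro!: vnorm_mono_set)
      have NiJ: "N i \<le> N J" using Nm i(1) by (simp add: strict_mono_less_eq)
      have X1s: "X1 \<subseteq> {1..N i}" and Y1s: "Y1 \<subseteq> {1..N i}" using XY by (auto simp: defs Suc_le_eq)
      have small: "cmod (hform \<gamma> U V a b) \<le> \<eta> * (x * y)"
        if "hform_le \<gamma> A B \<eta>" "U \<subseteq> A" "V \<subseteq> B" "finite U" "finite V" "vnorm U a \<le> x" "vnorm V b \<le> y" for \<gamma> A B U V
      proof -
        have "cmod (hform \<gamma> U V a b) \<le> \<eta> * vnorm U a * vnorm V b"
          by (rule hform_leD[OF that(1)]) (use that in auto)
        also have "\<dots> \<le> \<eta> * (x * y)"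
          unfolding mult.assoc using that \<eta> xy by (intro mult_left_mono mult_mono) auto
        finally show ?thesis .
      qed
      have t1: "cmod (hform (\<tau> k) X1 (Y1 \<union> Y2) a b) \<le> \<eta> * (x * y)"
        using X1s NiJ XY sub fin le by (intro small[OF k]) auto
      have t2: "cmod (hform (\<tau> k) X2 Y1 a b) \<le> \<eta> * (x * y)"
        using Y1s NiJ XY sub fin le by (intro small[OF hform_le_swap[OF k]]) auto
      have s1: "cmod (hform \<sigma> X1 Y2 a b) \<le> \<eta> * (x * y)"
        using X1s fin le by (intro small[OF N(3)[of i]]) (auto simp: defs)
      have s2: "cmod (hform \<sigma> X2 Y1 a b) \<le> \<eta> * (x * y)"
        using Y1s fin le by (intro small[OF hform_le_swap[OF N(3)[of i]]]) (auto simp: defs)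
      have s0: "cmod (hform \<sigma> X1 Y1 a b) \<le> d * vnorm X1 a * vnorm Y1 b"
        using XY sub fin by (intro hform_leD[OF \<sigma>]) auto
      have s3: "cmod (hform \<sigma> X2 Y2 a b) \<le> (s + \<eta>) * vnorm X2 a * vnorm Y2 b"
        using N(1)[of "Suc i"] fin by (intro hform_leD[OF k0]) (auto simp: defs)
      have t3: "cmod (hform (\<tau> k) X2 Y2 a b) \<le> G * vnorm X2 a * vnorm Y2 b"
        using XY sub fin by (intro hform_leD[OF \<tau>]) auto
      have all: "hform_le (\<lambda>n. \<sigma> n + \<tau> k n) pos pos (d + G)"
        by (rule hform_le_add[OF \<sigma> \<tau>])
      have b1: "cmod (?h (X1 \<union> X2) Yb a b) \<le> \<eta> * (x * y)"
      proof -
        have "cmod (?h (X1 \<union> X2) Yb a b) \<le> (d + G) * vnorm (X1 \<union> X2) a * vnorm Yb b"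
          using XY sub fin by (intro hform_leD[OF all]) auto
        also have "\<dots> \<le> (d + G) * (x * vnorm Yb b)"
          unfolding mult.assoc using le dG by (intro mult_left_mono mult_right_mono) auto
        also have "\<dots> \<le> (d + G) * (sqrt (2 / J) * (x * y))"
          using i(3) dG unfolding Yb_def by (intro mult_left_mono) auto
        also have "\<dots> \<le> \<eta> * (x * y)"
          unfolding mult.assoc[symmetric] using J(2) xy by (intro mult_right_mono) auto
        finally show ?thesis .
      qed
      have b2: "cmod (?h Xb Y a b) \<le> \<eta> * (x * y)"
      proof -
        have "cmod (?h Xb Y a b) \<le> (d + G) * vnorm Xb a * vnorm Y b"
          using XY sub fin by (intro hform_leD[OF all]) auto
        also have "\<dots> \<le> (d + G) * (sqrt (2 / J) * (x * y))"
          using i(2) dG unfolding Xb_def y_def mult.assoc by (intro mult_left_mono) auto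
        also have "\<dots> \<le> \<eta> * (x * y)"
          unfolding mult.assoc[symmetric] using J(2) xy by (intro mult_right_mono) auto
        finally show ?thesis .
      qed
      define u v w where "u = vnorm X1 a * vnorm Y1 b" and "v = vnorm X2 a * vnorm Y2 b" and "w = x * y"
      have uvw: "u \<ge> 0" "v \<ge> 0" "w \<ge> 0" "u + v \<le> w"
        unfolding u_def v_def w_def x_def y_def using XY sub disj by (auto intro!: two_block_vnorm_le)
      have "?h X Y a b = ?h X1 (Y1 \<union> Y2) a b + ?h X2 Y1 a b + ?h X2 Y2 a b + ?h (X1 \<union> X2) Yb a b + ?h Xb Y a b"
        using hform_cross_decomposition[OF fin disj] unfolding split by blast
      \<comment> \<open>Two main blocks, \<sigma> below the band and \<sigma> + \<tau> above it,
        followed by six errors: \<sigma> across the band twice, \<tau> touching the head twice, and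
        the band itself twice.\<close>
      then have eq: "?h X Y a b = hform \<sigma> X1 Y1 a b + (hform \<sigma> X2 Y2 a b + hform (\<tau> k) X2 Y2 a b)
          + (hform \<sigma> X1 Y2 a b + hform \<sigma> X2 Y1 a b + hform (\<tau> k) X1 (Y1 \<union> Y2) a b + hform (\<tau> k) X2 Y1 a b
          + ?h (X1 \<union> X2) Yb a b + ?h Xb Y a b)"
        using fin disj by (simp add: hform_add_symbol hform_union_right)
      have "cmod (?h X Y a b) \<le> d * vnorm X1 a * vnorm Y1 b + ((s + \<eta>) * vnorm X2 a * vnorm Y2 b + G * vnorm X2 a * vnorm Y2 b)
          + (\<eta> * (x * y) + \<eta> * (x * y) + \<eta> * (x * y) + \<eta> * (x * y) + \<eta> * (x * y) + \<eta> * (x * y))"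
        unfolding eq by (intro norm_triangle_mono s0 s1 s2 s3 t1 t2 t3 b1 b2)
      also have "\<dots> = d * u + (s + \<eta> + G) * v + 6 * \<eta> * w"
        unfolding u_def v_def w_def by (simp add: algebra_simps)
      also have "\<dots> \<le> (max d (s + G) + \<eta>) * u + (max d (s + G) + \<eta>) * v + 6 * \<eta> * w"
      proof -
        have "d \<le> max d (s + G) + \<eta>" "s + \<eta> + G \<le> max d (s + G) + \<eta>" using \<eta> by auto
        then have "d * u \<le> (max d (s + G) + \<eta>) * u" "(s + \<eta> + G) * v \<le> (max d (s + G) + \<eta>) * v"
          using uvw by (auto intro!: mult_right_mono)
        then show ?thesis by linarith
      qed
      \<comment> \<open>Both main blocks now carry the same constant, so u + v \<le> w prevents the
        norms from adding up.\<close>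
      also have "\<dots> = (max d (s + G) + \<eta>) * (u + v) + 6 * \<eta> * w"
        by (simp only: distrib_left)
      also have "\<dots> \<le> (max d (s + G) + \<eta>) * w + 6 * \<eta> * w"
        using \<eta> dG uvw by (intro add_mono order_refl mult_left_mono) auto
      also have "\<dots> = (max d (s + G) + 7 * \<eta>) * w" by (simp add: distrib_right)
      also have "\<dots> \<le> (max d (s + G) + g) * w"
        using uvw \<eta> by (intro mult_right_mono) (auto simp: \<eta>_def)
      finally show "cmod (?h X Y a b) \<le> (max d (s + G) + g) * vnorm X a * vnorm Y b"
        unfolding w_def x_def y_def by (simp add: mult.assoc)
    qed
  qed
qed

subsection \<open>Hankel operators and compactness on \<open>\<ell>\<^sup>2\<close>\<close>

text \<open>Vectors on arbitrary finite sets are padded by zeros to \<open>{1..N}\<close>, and the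
  conjugate in the definition is absorbed into the second vector.\<close>

lemma hankel_bounded_iff: "hankel_bounded \<gamma> \<longleftrightarrow> (\<exists>C. hform_le \<gamma> pos pos C)"
proof
  assume "hankel_bounded \<gamma>"
  then obtain C where C: "\<And>a b N. cmod (\<Sum>n=1..N. \<Sum>m=1..N. a n * cnj (b m) * \<gamma> (n * m))
       \<le> C * sqrt (\<Sum>n=1..N. (cmod (a n))\<^sup>2) * sqrt (\<Sum>m=1..N. (cmod (b m))\<^sup>2)"
    unfolding hankel_bounded_def by blast
  have "hform_le \<gamma> pos pos C"
  proof (rule hform_leI)
    fix X Y and a b :: "nat \<Rightarrow> complex"
    assume XY: "finite X" "finite Y" "X \<subseteq> pos" "Y \<subseteq> pos"
    obtain N where N: "X \<union> Y \<subseteq> {..<N}"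
      using finite_nat_iff_bounded XY by (metis finite_Un)
    have sub: "X \<subseteq> {1..N}" "Y \<subseteq> {1..N}" using N XY by (force simp: Suc_le_eq)+
    define a' where "a' n = (if n \<in> X then a n else 0)" for n
    define b' where "b' n = (if n \<in> Y then cnj (b n) else 0)" for n
    have "hform \<gamma> X Y a b = (\<Sum>n\<in>X. \<Sum>m=1..N. a' n * cnj (b' m) * \<gamma> (n * m))"
      unfolding hform_def using sub
      by (intro sum.cong refl sum.mono_neutral_cong_left) (auto simp: a'_def b'_def)
    also have "\<dots> = (\<Sum>n=1..N. \<Sum>m=1..N. a' n * cnj (b' m) * \<gamma> (n * m))"
      using sub by (intro sum.mono_neutral_cong_left) (auto simp: a'_def)
    finally have 1: "hform \<gamma> X Y a b = (\<Sum>n=1..N. \<Sum>m=1..N. a' n * cnj (b' m) * \<gamma> (n * m))" .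
    have 2: "(\<Sum>n=1..N. (cmod (a' n))\<^sup>2) = (\<Sum>n\<in>X. (cmod (a n))\<^sup>2)"
      using sub by (intro sum.mono_neutral_cong_right) (auto simp: a'_def)
    have 3: "(\<Sum>n=1..N. (cmod (b' n))\<^sup>2) = (\<Sum>n\<in>Y. (cmod (b n))\<^sup>2)"
      using sub by (intro sum.mono_neutral_cong_right) (auto simp: b'_def)
    show "cmod (hform \<gamma> X Y a b) \<le> C * vnorm X a * vnorm Y b"
      using C[where N = N and a = a' and b = b'] unfolding 1 2 3 L2_set_def .
  qed
  then show "\<exists>C. hform_le \<gamma> pos pos C" ..
next
  assume "\<exists>C. hform_le \<gamma> pos pos C"
  then obtain C where C: "hform_le \<gamma> pos pos C" ..
  \<comment> \<open>\<open>hankel_bounded\<close> asks for a strictly positive constant, while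
    \<open>C\<close> may be 0.\<close>
  then have C': "hform_le \<gamma> pos pos (C + 1)" by (rule hform_le_weaken) simp
  show "hankel_bounded \<gamma>"
    unfolding hankel_bounded_def
  proof (intro exI conjI allI)
    show "C + 1 > 0" using hform_le_nonneg[OF C] by simp
    fix a b N
    show "cmod (\<Sum>n=1..N. \<Sum>m=1..N. a n * cnj (b m) * \<gamma> (n * m))
       \<le> (C + 1) * sqrt (\<Sum>n=1..N. (cmod (a n))\<^sup>2) * sqrt (\<Sum>m=1..N. (cmod (b m))\<^sup>2)"
      using hform_leD[OF C', of "{1..N}" "{1..N}" a "\<lambda>m. cnj (b m)"]
      by (simp add: hform_def L2_set_def subset_iff)
  qed
qed

section \<open>The space of square-summable sequences and its finite sections\<close>

lemma l2norm_nonneg: "a \<in> l2 \<Longrightarrow> 0 \<le> l2norm a"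
  unfolding l2norm_def l2_def by (auto intro!: suminf_nonneg)

lemma l2norm_zero [simp]: "l2norm (\<lambda>n. 0) = 0"
  unfolding l2norm_def by simp

lemma zero_in_l2: "(\<lambda>n. 0) \<in> l2"
  unfolding l2_def by simp

lemma vnorm_le_l2norm: "a \<in> l2 \<Longrightarrow> finite X \<Longrightarrow> vnorm X a \<le> l2norm a"
  unfolding l2norm_def L2_set_def l2_def by (auto intro!: sum_le_suminf)

text \<open>Passes from finite sections to the whole sequence. The sections start at 1, so the
  vanishing at the dummy index 0 is supplied separately.\<close>

lemma l2_boundedI:
  assumes y0: "y 0 = 0" and B: "\<And>N. vnorm {1..N} y \<le> B"
  shows "y \<in> l2" "l2norm y \<le> B"
proof -
  have B0: "B \<ge> 0" using B[of 0] by simp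
  have part: "(\<Sum>n<N. (cmod (y n))\<^sup>2) \<le> B\<^sup>2" for N
  proof -
    have "(\<Sum>n<N. (cmod (y n))\<^sup>2) \<le> (\<Sum>n\<in>insert 0 {1..N}. (cmod (y n))\<^sup>2)"
      by (intro sum_mono2) auto
    also have "\<dots> = (vnorm {1..N} y)\<^sup>2" unfolding vnorm_sq using y0 by simp
    also have "\<dots> \<le> B\<^sup>2" using B by (intro power_mono) auto
    finally show ?thesis .
  qed
  have sm: "summable (\<lambda>n. (cmod (y n))\<^sup>2)"
    by (rule summableI_nonneg_bounded[OF _ part]) simp
  then show "y \<in> l2" using y0 by (simp add: l2_def)
  have "(\<Sum>n. (cmod (y n))\<^sup>2) \<le> B\<^sup>2" by (rule suminf_le_const[OF sm part])
  then show "l2norm y \<le> B" unfolding l2norm_def using B0 by (simp add: real_le_lsqrt suminf_nonneg[OF sm])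
qed

lemma vnorm_add_le: "vnorm X (\<lambda>n. a n + b n) \<le> vnorm X a + vnorm X b"
  by (rule order_trans[OF L2_set_mono L2_set_triangle_ineq]) (auto intro: norm_triangle_ineq)

lemma vnorm_diff_le: "vnorm X (\<lambda>n. a n - b n) \<le> vnorm X a + vnorm X b"
  by (rule order_trans[OF L2_set_mono L2_set_triangle_ineq]) (auto intro: norm_triangle_ineq4)

lemma vnorm_scale: "vnorm X (\<lambda>n. c * a n) = cmod c * vnorm X a"
  by (simp add: norm_mult L2_set_right_distrib)

lemma l2_scale:
  assumes "a \<in> l2"
  shows "(\<lambda>n. c * a n) \<in> l2" "l2norm (\<lambda>n. c * a n) \<le> cmod c * l2norm a"
proof -
  have 0: "c * a 0 = 0" using assms by (simp add: l2_def)
  have B: "vnorm {1..N} (\<lambda>n. c * a n) \<le> cmod c * l2norm a" for N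
    unfolding vnorm_scale by (intro mult_left_mono vnorm_le_l2norm assms) auto
  show "(\<lambda>n. c * a n) \<in> l2" "l2norm (\<lambda>n. c * a n) \<le> cmod c * l2norm a"
    by (rule l2_boundedI[OF 0 B])+
qed

lemma l2_diff:
  assumes "a \<in> l2" "b \<in> l2"
  shows "(\<lambda>n. a n - b n) \<in> l2" "l2norm (\<lambda>n. a n - b n) \<le> l2norm a + l2norm b"
proof -
  have 0: "a 0 - b 0 = 0" using assms by (simp add: l2_def)
  have B: "vnorm {1..N} (\<lambda>n. a n - b n) \<le> l2norm a + l2norm b" for N
    by (intro order_trans[OF vnorm_diff_le] add_mono vnorm_le_l2norm assms) auto
  show "(\<lambda>n. a n - b n) \<in> l2" "l2norm (\<lambda>n. a n - b n) \<le> l2norm a + l2norm b"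
    by (rule l2_boundedI[OF 0 B])+
qed

lemma l2_finite_support:
  assumes "finite X" "X \<subseteq> pos"
  shows "(\<lambda>n. if n \<in> X then a n else 0) \<in> l2" "l2norm (\<lambda>n. if n \<in> X then a n else 0) \<le> vnorm X a"
proof -
  let ?a = "\<lambda>n. if n \<in> X then a n else 0"
  have 0: "?a 0 = 0" using assms by auto
  have B: "vnorm {1..N} ?a \<le> vnorm X a" for N
  proof -
    have "vnorm {1..N} ?a = vnorm ({1..N} \<inter> X) a"
      unfolding L2_set_def
      by (intro arg_cong[where f = sqrt] sum.mono_neutral_cong_right) auto
    also have "\<dots> \<le> vnorm X a" using assms by (intro vnorm_mono_set) auto
    finally show ?thesis .
  qed
  show "?a \<in> l2" "l2norm ?a \<le> vnorm X a" by (rule l2_boundedI[OF 0 B])+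
qed

section \<open>Hankel operators on square-summable sequences\<close>

text \<open>Comparison by xy \<le> x^2 + y^2 with the square-summable vector and row. It guarantees
  that the series in \<open>hankel_op\<close> converges.\<close>

lemma hankel_row_summable:
  assumes h: "hform_le \<gamma> pos pos C" and a: "a \<in> l2" and m: "m > 0"
  shows "summable (\<lambda>n. a (Suc n) * \<gamma> (Suc n * m))"
proof (rule summable_comparison_test)
  have "summable (\<lambda>n. (cmod (a (Suc n)))\<^sup>2)" 
    using a summable_Suc_iff[of "\<lambda>n. (cmod (a n))\<^sup>2"] by (simp add: l2_def)
  then show "summable (\<lambda>n. (cmod (a (Suc n)))\<^sup>2 + (cmod (\<gamma> (m * Suc n)))\<^sup>2)"
    by (intro summable_add row_summable[OF h m])
  have "x * y \<le> x\<^sup>2 + y\<^sup>2" if "x \<ge> 0" "y \<ge> 0" for x y :: real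
    using that sum_squares_bound[of x y] mult_nonneg_nonneg[OF that] by linarith
  then show "\<exists>N. \<forall>n\<ge>N. cmod (a (Suc n) * \<gamma> (Suc n * m)) \<le> (cmod (a (Suc n)))\<^sup>2 + (cmod (\<gamma> (m * Suc n)))\<^sup>2"
    by (simp add: norm_mult mult.commute[of m])
qed

lemma hankel_op_LIMSEQ:
  assumes "hform_le \<gamma> pos pos C" "a \<in> l2" "m > 0"
  shows "(\<lambda>N. \<Sum>n=1..N. a n * \<gamma> (n * m)) \<longlonglongrightarrow> hankel_op \<gamma> a m"
  using summable_LIMSEQ[OF hankel_row_summable[OF assms]] assms(3)
  by (simp add: hankel_op_def sum.atLeast1_atMost_eq)

text \<open>Duality: the form is tested on \<open>a\<close> and the conjugate of the image
  restricted to \<open>Y\<close>, and one factor of the norm is cancelled. The global bound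
  \<open>D\<close> makes the series converge; the bound \<open>C\<close> on the columns in
  \<open>B\<close> gives the estimate.\<close>

lemma hankel_op_vnorm_le:
  assumes h: "hform_le \<gamma> pos pos D" and hB: "hform_le \<gamma> pos B C" and C: "C \<ge> 0" and B: "B \<subseteq> pos"
    and a: "a \<in> l2" and Y: "finite Y" "Y \<subseteq> B"
  shows "vnorm Y (hankel_op \<gamma> a) \<le> C * l2norm a"
proof -
  let ?y = "hankel_op \<gamma> a"
  let ?v = "vnorm Y ?y"
  have "(\<lambda>N. \<Sum>m\<in>Y. cnj (?y m) * (\<Sum>n=1..N. a n * \<gamma> (n * m))) \<longlonglongrightarrow> (\<Sum>m\<in>Y. cnj (?y m) * ?y m)"
    using B Y by (intro tendsto_intros hankel_op_LIMSEQ[OF h a]) auto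
  moreover have "(\<Sum>m\<in>Y. cnj (?y m) * (\<Sum>n=1..N. a n * \<gamma> (n * m))) = hform \<gamma> {1..N} Y a (\<lambda>m. cnj (?y m))" for N
    unfolding hform_def by (subst sum.swap) (simp add: sum_distrib_left mult_ac)
  moreover have "(\<Sum>m\<in>Y. cnj (?y m) * ?y m) = of_real (?v\<^sup>2)"
    unfolding vnorm_sq of_real_sum by (simp add: mult.commute[of "cnj _"] flip: complex_norm_square)
  ultimately have "(\<lambda>N. hform \<gamma> {1..N} Y a (\<lambda>m. cnj (?y m))) \<longlonglongrightarrow> of_real (?v\<^sup>2)" by simp
  then have "(\<lambda>N. cmod (hform \<gamma> {1..N} Y a (\<lambda>m. cnj (?y m)))) \<longlonglongrightarrow> cmod (of_real (?v\<^sup>2))"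
    by (rule tendsto_norm)
  moreover have "cmod (hform \<gamma> {1..N} Y a (\<lambda>m. cnj (?y m))) \<le> C * l2norm a * ?v" for N
  proof -
    have "cmod (hform \<gamma> {1..N} Y a (\<lambda>m. cnj (?y m))) \<le> C * vnorm {1..N} a * vnorm Y (\<lambda>m. cnj (?y m))"
      using Y by (intro hform_leD[OF hB]) auto
    also have "\<dots> \<le> C * l2norm a * ?v"
      using C a by (auto intro!: mult_right_mono mult_left_mono vnorm_le_l2norm)
    finally show ?thesis .
  qed
  ultimately have "cmod (of_real (?v\<^sup>2)) \<le> C * l2norm a * ?v"
    by (intro LIMSEQ_le_const2) auto
  then have "?v * ?v \<le> C * l2norm a * ?v" by (simp add: norm_power power2_eq_square norm_mult)
  moreover have "0 \<le> C * l2norm a" using C l2norm_nonneg[OF a] by simp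
  ultimately show ?thesis by (cases "?v = 0") (auto simp: mult_le_cancel_right)
qed

lemma hankel_op_l2:
  assumes h: "hform_le \<gamma> pos pos C" and a: "a \<in> l2"
  shows "hankel_op \<gamma> a \<in> l2" "l2norm (hankel_op \<gamma> a) \<le> C * l2norm a"
proof -
  have 0: "hankel_op \<gamma> a 0 = 0" by (simp add: hankel_op_def)
  have B: "vnorm {1..N} (hankel_op \<gamma> a) \<le> C * l2norm a" for N
    by (rule hankel_op_vnorm_le[OF h h hform_le_nonneg[OF h] _ a]) auto
  show "hankel_op \<gamma> a \<in> l2" "l2norm (hankel_op \<gamma> a) \<le> C * l2norm a"
    by (rule l2_boundedI[OF 0 B])+
qed

lemma bounded_hankel_op:
  assumes h: "hform_le \<gamma> pos pos C"
  shows "bounded_op (hankel_op \<gamma>)"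
  unfolding bounded_op_def
proof (intro conjI ballI allI exI)
  fix a b c assume a: "a \<in> l2" and b: "b \<in> l2"
  show "hankel_op \<gamma> (\<lambda>n. a n + c * b n) = (\<lambda>n. hankel_op \<gamma> a n + c * hankel_op \<gamma> b n)"
  proof
    fix m
    show "hankel_op \<gamma> (\<lambda>n. a n + c * b n) m = hankel_op \<gamma> a m + c * hankel_op \<gamma> b m"
    proof (cases "m = 0")
      case False
      then have m: "m > 0" by simp
      have "(\<lambda>n. a (Suc n) * \<gamma> (Suc n * m) + c * (b (Suc n) * \<gamma> (Suc n * m))) sums
         (hankel_op \<gamma> a m + c * hankel_op \<gamma> b m)"
        using summable_sums[OF hankel_row_summable[OF h a m]] summable_sums[OF hankel_row_summable[OF h b m]] m
        by (auto intro!: sums_add sums_mult simp: hankel_op_def)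
      then show ?thesis using m by (simp add: hankel_op_def sums_iff algebra_simps)
    qed (simp add: hankel_op_def)
  qed
qed (use hankel_op_l2[OF h] in auto)

lemma op_diff_hankel:
  assumes "hform_le \<alpha> pos pos C" "hform_le \<beta> pos pos D" and a: "a \<in> l2"
  shows "op_diff (hankel_op \<alpha>) (hankel_op \<beta>) a = hankel_op (\<lambda>n. \<alpha> n - \<beta> n) a"
proof
  fix m
  show "op_diff (hankel_op \<alpha>) (hankel_op \<beta>) a m = hankel_op (\<lambda>n. \<alpha> n - \<beta> n) a m"
    using suminf_diff[OF hankel_row_summable[OF assms(1) a] hankel_row_summable[OF assms(2) a], of m m]
    by (cases "m = 0") (auto simp: op_diff_def hankel_op_def algebra_simps)
qed

section \<open>Bounded operators and the operator norm\<close>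

lemma bounded_op_l2: "bounded_op T \<Longrightarrow> a \<in> l2 \<Longrightarrow> T a \<in> l2"
  by (simp add: bounded_op_def)

lemma bounded_op_le:
  assumes "bounded_op T"
  obtains C where "C \<ge> 0" "\<And>a. a \<in> l2 \<Longrightarrow> l2norm (T a) \<le> C * l2norm a"
proof -
  obtain C where C: "\<And>a. a \<in> l2 \<Longrightarrow> l2norm (T a) \<le> C * l2norm a"
    using assms unfolding bounded_op_def by blast
  have "l2norm (T a) \<le> max C 0 * l2norm a" if "a \<in> l2" for a
    by (rule order_trans[OF C[OF that]]) (auto intro!: mult_right_mono l2norm_nonneg that)
  then show ?thesis using that[of "max C 0"] by auto
qed

lemma bounded_op_scale:
  assumes T: "bounded_op T" and a: "a \<in> l2"
  shows "T (\<lambda>n. c * a n) = (\<lambda>n. c * T a n)"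
proof -
  have lin: "T (\<lambda>n. a n + c * b n) = (\<lambda>n. T a n + c * T b n)" if "a \<in> l2" "b \<in> l2" for a b c
    using T that by (simp add: bounded_op_def)
  \<comment> \<open>Linearity is given in the form a + c b, so T 0 = 0 is first derived from T 0 = T
    0 + T 0; then homogeneity is the case a = 0.\<close>
  have "T (\<lambda>n. 0) = (\<lambda>n. T (\<lambda>n. 0) n + 1 * T (\<lambda>n. 0) n)"
    using lin[OF zero_in_l2 zero_in_l2, of 1] by simp
  then have "T (\<lambda>n. 0) n = 0" for n by (metis add_cancel_right_right mult_1)
  then show ?thesis using lin[OF zero_in_l2 a, of c] by simp
qed

lemma bounded_op_diff:
  assumes S: "bounded_op S" and T: "bounded_op T"
  shows "bounded_op (op_diff S T)"
proof -
  obtain C D where C: "\<And>a. a \<in> l2 \<Longrightarrow> l2norm (S a) \<le> C * l2norm a"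
    and D: "\<And>a. a \<in> l2 \<Longrightarrow> l2norm (T a) \<le> D * l2norm a"
    using S T unfolding bounded_op_def by blast
  have "l2norm (op_diff S T a) \<le> (C + D) * l2norm a" if a: "a \<in> l2" for a
    using l2_diff(2)[OF bounded_op_l2[OF S a] bounded_op_l2[OF T a]] C[OF a] D[OF a]
    by (simp add: op_diff_def distrib_right)
  moreover have "op_diff S T a \<in> l2" if a: "a \<in> l2" for a
    using l2_diff(1)[OF bounded_op_l2[OF S a] bounded_op_l2[OF T a]] by (simp add: op_diff_def)
  moreover have "op_diff S T (\<lambda>n. a n + c * b n) = (\<lambda>n. op_diff S T a n + c * op_diff S T b n)"
    if "a \<in> l2" "b \<in> l2" for a b c
    using S T that by (auto simp: bounded_op_def op_diff_def algebra_simps)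
  ultimately show ?thesis unfolding bounded_op_def by blast
qed

lemma op_norm_le:
  assumes "\<And>a. a \<in> l2 \<Longrightarrow> l2norm (T a) \<le> C * l2norm a" "C \<ge> 0"
  shows "op_norm T \<le> C"
  unfolding op_norm_def
proof (rule cSup_least)
  show "{l2norm (T a) |a. a \<in> l2 \<and> l2norm a \<le> 1} \<noteq> {}"
    using zero_in_l2 l2norm_zero by force
  fix x assume "x \<in> {l2norm (T a) |a. a \<in> l2 \<and> l2norm a \<le> 1}"
  then obtain a where a: "a \<in> l2" "l2norm a \<le> 1" "x = l2norm (T a)" by blast
  have "x \<le> C * l2norm a" using assms(1) a by simp
  also have "\<dots> \<le> C" using assms(2) a(2) by (simp add: mult_left_le)
  finally show "x \<le> C" .
qed

lemma op_norm_ge: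
  assumes T: "bounded_op T" and a: "a \<in> l2" "l2norm a \<le> 1"
  shows "l2norm (T a) \<le> op_norm T"
  unfolding op_norm_def
proof (rule cSup_upper)
  obtain C where C: "C \<ge> 0" "\<And>a. a \<in> l2 \<Longrightarrow> l2norm (T a) \<le> C * l2norm a"
    using bounded_op_le[OF T] by blast
  show "bdd_above {l2norm (T a) |a. a \<in> l2 \<and> l2norm a \<le> 1}"
  proof (rule bdd_aboveI)
    fix x assume "x \<in> {l2norm (T a) |a. a \<in> l2 \<and> l2norm a \<le> 1}"
    then obtain a where a: "a \<in> l2" "l2norm a \<le> 1" "x = l2norm (T a)" by blast
    have "x \<le> C * l2norm a" using C(2) a by simp
    also have "\<dots> \<le> C" using C(1) a(2) by (simp add: mult_left_le)
    finally show "x \<le> C" .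
  qed
qed (use a in blast)

lemma op_norm_nonneg: "bounded_op T \<Longrightarrow> 0 \<le> op_norm T"
  using op_norm_ge[of T "\<lambda>n. 0"] l2norm_nonneg[OF bounded_op_l2, of T "\<lambda>n. 0"]
  by (simp add: zero_in_l2)

lemma l2norm_le_op_norm:
  assumes T: "bounded_op T" and a: "a \<in> l2"
  shows "l2norm (T a) \<le> op_norm T * l2norm a"
proof (cases "l2norm a = 0")
  case True
  then show ?thesis using bounded_op_le[OF T] a by (metis mult_zero_right)
next
  case False
  let ?r = "l2norm a"
  let ?u = "\<lambda>n. of_real (1 / ?r) * a n"
  have r: "?r > 0" using False l2norm_nonneg[OF a] by simp
  have "l2norm ?u \<le> cmod (of_real (1 / ?r)) * ?r" by (rule l2_scale(2)[OF a])
  also have "\<dots> = 1" using r by (simp add: norm_divide)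
  finally have u: "l2norm (T ?u) \<le> op_norm T"
    by (intro op_norm_ge[OF T] l2_scale(1)[OF a])
  have "T a = T (\<lambda>n. of_real ?r * ?u n)" using r by (simp add: field_simps)
  also have "\<dots> = (\<lambda>n. of_real ?r * T ?u n)" by (rule bounded_op_scale[OF T l2_scale(1)[OF a]])
  finally have "l2norm (T a) \<le> cmod (of_real ?r) * l2norm (T ?u)"
    by (simp only: l2_scale(2)[OF bounded_op_l2[OF T l2_scale(1)[OF a]]])
  also have "\<dots> \<le> op_norm T * ?r"
    using u r by (simp add: mult.commute)
  finally show ?thesis .
qed

section \<open>Compactness as uniform smallness of tails\<close>

text \<open>A diagonal subsequence makes the images converge in every coordinate; uniformly small
  tails upgrade this to convergence in norm.\<close>

lemma compact_opI:
  assumes T: "bounded_op T"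
    and tail: "\<And>\<delta>. \<delta> > 0 \<Longrightarrow> \<exists>k. \<forall>a\<in>l2. \<forall>N. vnorm {k<..N} (T a) \<le> \<delta> * l2norm a"
  shows "compact_op T"
  unfolding compact_op_def
proof (intro conjI T allI impI, elim conjE exE)
  fix x :: "nat \<Rightarrow> nat \<Rightarrow> complex" and B
  assume x: "\<forall>k. x k \<in> l2" and B: "\<forall>k. l2norm (x k) \<le> B"
  have B0: "B \<ge> 0" using l2norm_nonneg[of "x 0"] x B by (meson order_trans)
  obtain C where C: "C \<ge> 0" "\<And>a. a \<in> l2 \<Longrightarrow> l2norm (T a) \<le> C * l2norm a"
    using bounded_op_le[OF T] by blast
  have Tx: "T (x k) \<in> l2" for k using x bounded_op_l2[OF T] by blast
  have Tn: "l2norm (T (x k)) \<le> C * B" for k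
    using C(2)[of "x k"] x mult_left_mono[OF B[rule_format, of k] C(1)] by auto
  have bd: "cmod (T (x k) n) \<le> C * B" for k n
    using vnorm_le_l2norm[OF Tx, of "{n}" k] Tn[of k] by simp
  obtain r where r: "strict_mono r" "\<And>n. \<exists>l. (\<lambda>k. T (x (r k)) n) \<longlonglongrightarrow> l"
    by (rule function_convergent_subsequence[of UNIV "\<lambda>k. T (x k)" "C * B"]) (use bd in auto)
  then obtain y where y: "\<And>n. (\<lambda>k. T (x (r k)) n) \<longlonglongrightarrow> y n" by metis
  have T0: "T (x k) 0 = 0" for k using Tx[of k] by (simp add: l2_def)
  have y0: "y 0 = 0" using y[of 0] by (simp add: T0 LIMSEQ_const_iff)
  have limv: "(\<lambda>k. vnorm X (\<lambda>n. T (x (r k)) n)) \<longlonglongrightarrow> vnorm X y" for X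
    unfolding L2_set_def by (intro tendsto_intros y)
  have "vnorm {1..N} y \<le> C * B" for N
    by (rule LIMSEQ_le_const2[OF limv]) (use vnorm_le_l2norm[OF Tx] Tn in \<open>meson finite_atLeastAtMost order_trans\<close>)
  then have yl2: "y \<in> l2" by (rule l2_boundedI(1)[of y, OF y0])
  have "(\<lambda>k. l2norm (\<lambda>n. T (x (r k)) n - y n)) \<longlonglongrightarrow> 0"
  proof (rule LIMSEQ_I)
    fix \<epsilon> :: real assume \<epsilon>: "\<epsilon> > 0"
    \<comment> \<open>The head of the difference and the tails of the image and of the limit get
      \<epsilon>/4 each. The summand 1 covers B = 0.\<close>
    define \<delta> where "\<delta> = \<epsilon> / (4 * (B + 1))"
    have \<delta>: "\<delta> > 0" "\<delta> * B \<le> \<epsilon> / 4" using \<epsilon> B0 by (auto simp: \<delta>_def field_simps)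
    obtain k0 where k0: "\<And>a N. a \<in> l2 \<Longrightarrow> vnorm {k0<..N} (T a) \<le> \<delta> * l2norm a" using tail[OF \<delta>(1)] by blast
    have tx: "vnorm {k0<..N} (T (x k)) \<le> \<epsilon> / 4" for k N
    proof -
      have "vnorm {k0<..N} (T (x k)) \<le> \<delta> * l2norm (x k)" using k0 x by blast
      also have "\<dots> \<le> \<delta> * B" using B \<delta> by (intro mult_left_mono) auto
      finally show ?thesis using \<delta>(2) by simp
    qed
    have ty: "vnorm {k0<..N} y \<le> \<epsilon> / 4" for N
      by (rule LIMSEQ_le_const2[OF limv]) (use tx in blast)
    have "(\<lambda>k. vnorm {1..k0} (\<lambda>n. T (x (r k)) n - y n)) \<longlonglongrightarrow> vnorm {1..k0} (\<lambda>n. y n - y n)"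
      unfolding L2_set_def by (intro tendsto_intros y)
    then have "(\<lambda>k. vnorm {1..k0} (\<lambda>n. T (x (r k)) n - y n)) \<longlonglongrightarrow> 0" by (simp add: L2_set_def)
    then obtain M where M: "\<And>k. k \<ge> M \<Longrightarrow> vnorm {1..k0} (\<lambda>n. T (x (r k)) n - y n) < \<epsilon> / 4"
      using order_tendstoD(2)[of _ 0 sequentially "\<epsilon> / 4"] \<epsilon> unfolding eventually_sequentially by force
    have "norm (l2norm (\<lambda>n. T (x (r k)) n - y n) - 0) < \<epsilon>" if k: "k \<ge> M" for k
    proof -
      let ?d = "\<lambda>n. T (x (r k)) n - y n"
      have "vnorm {1..N} ?d \<le> 3 * \<epsilon> / 4" for N
      proof -
        have "vnorm {1..N} ?d \<le> vnorm ({1..k0} \<union> {k0<..N}) ?d"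
          by (intro vnorm_mono_set) auto
        also have "\<dots> \<le> vnorm {1..k0} ?d + vnorm {k0<..N} ?d"
          by (intro vnorm_union_le) auto
        also have "\<dots> \<le> vnorm {1..k0} ?d + (vnorm {k0<..N} (T (x (r k))) + vnorm {k0<..N} y)"
          by (intro add_left_mono vnorm_diff_le)
        finally show ?thesis using M[OF k] tx[where k = "r k" and N = N] ty[of N] by linarith
      qed
      then have "?d \<in> l2" "l2norm ?d \<le> 3 * \<epsilon> / 4"
        using l2_boundedI[of ?d "3 * \<epsilon> / 4"] y0 T0 by auto
      then show ?thesis using \<epsilon> l2norm_nonneg[of ?d] by simp
    qed
    then show "\<exists>M. \<forall>k\<ge>M. norm (l2norm (\<lambda>n. T (x (r k)) n - y n) - 0) < \<epsilon>" by blast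
  qed
  with r(1) yl2 show "\<exists>r y. strict_mono r \<and> y \<in> l2 \<and> (\<lambda>k. l2norm (\<lambda>n. T (x (r k)) n - y n)) \<longlonglongrightarrow> 0"
    by blast
qed

lemma l2_tail_small:
  assumes y: "y \<in> l2" and \<eta>: "\<eta> > 0"
  shows "\<exists>M. \<forall>k\<ge>M. \<forall>N. vnorm {k<..N} y \<le> \<eta>"
proof -
  obtain M where M: "\<And>k l. k \<ge> M \<Longrightarrow> norm (\<Sum>n\<in>{k..<l}. (cmod (y n))\<^sup>2) < \<eta>\<^sup>2"
    using y \<eta> unfolding l2_def summable_Cauchy mem_Collect_eq by (meson zero_less_power)
  have "vnorm {k<..N} y \<le> \<eta>" if k: "k \<ge> M" for k N
  proof -
    have "(vnorm {k<..N} y)\<^sup>2 \<le> (\<Sum>n\<in>{k..<Suc N}. (cmod (y n))\<^sup>2)"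
      unfolding vnorm_sq by (intro sum_mono2) auto
    also have "\<dots> \<le> \<eta>\<^sup>2" using M[OF k, of "Suc N"] by (simp add: sum_nonneg)
    finally show ?thesis using \<eta> by (simp add: power2_le_iff_abs_le)
  qed
  then show ?thesis by blast
qed

text \<open>Otherwise there are normalized vectors whose images keep mass above \<delta> beyond
  arbitrarily late indices. A convergent subsequence is impossible, since its limit has small
  tails.\<close>

lemma compact_op_tail:
  assumes K: "compact_op K" and \<delta>: "\<delta> > 0"
  shows "\<exists>k. \<forall>a\<in>l2. \<forall>N. vnorm {k<..N} (K a) \<le> \<delta> * l2norm a"
proof (rule ccontr)
  assume "\<not> ?thesis"
  then have "\<forall>k. \<exists>a N. a \<in> l2 \<and> vnorm {k<..N} (K a) > \<delta> * l2norm a" by (metis not_le)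
  then obtain a N where a: "\<And>k. a k \<in> l2" and aN: "\<And>k. vnorm {k<..N k} (K (a k)) > \<delta> * l2norm (a k)"
    by metis
  have Kb: "bounded_op K" using K by (simp add: compact_op_def)
  \<comment> \<open>A vector of norm 0 has an image of norm 0 and cannot violate the tail bound;
    hence normalizing is allowed.\<close>
  have pos: "l2norm (a k) > 0" for k
  proof (rule ccontr)
    assume "\<not> ?thesis"
    then have 0: "l2norm (a k) = 0" using l2norm_nonneg[OF a, of k] by simp
    have "vnorm {k<..N k} (K (a k)) \<le> l2norm (K (a k))"
      by (intro vnorm_le_l2norm bounded_op_l2[OF Kb] a) auto
    also have "\<dots> \<le> op_norm K * l2norm (a k)" by (rule l2norm_le_op_norm[OF Kb a])
    finally show False using aN[of k] 0 by simp
  qed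
  define c where "c k = complex_of_real (1 / l2norm (a k))" for k
  define x where "x k = (\<lambda>n. c k * a k n)" for k
  have c: "cmod (c k) * l2norm (a k) = 1" for k using pos[of k] by (simp add: c_def norm_divide)
  have cpos: "cmod (c k) > 0" for k using c[of k] by (metis mult_zero_left norm_ge_zero order_less_le zero_neq_one)
  have x: "x k \<in> l2" "l2norm (x k) \<le> 1" for k
    using l2_scale[OF a[of k], of "c k"] c[of k] by (auto simp: x_def)
  have xN: "vnorm {k<..N k} (K (x k)) > \<delta>" for k
  proof -
    have "K (x k) = (\<lambda>n. c k * K (a k) n)" unfolding x_def by (rule bounded_op_scale[OF Kb a])
    then have "vnorm {k<..N k} (K (x k)) = cmod (c k) * vnorm {k<..N k} (K (a k))" by (simp add: vnorm_scale)
    also have "\<dots> > cmod (c k) * (\<delta> * l2norm (a k))" using aN[of k] cpos[of k] by simp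
    also have "cmod (c k) * (\<delta> * l2norm (a k)) = \<delta>" using c[of k] by (metis mult.left_commute mult.right_neutral)
    finally show ?thesis .
  qed
  obtain r y where r: "strict_mono r" and y: "y \<in> l2" and lim: "(\<lambda>k. l2norm (\<lambda>n. K (x (r k)) n - y n)) \<longlonglongrightarrow> 0"
    using K x unfolding compact_op_def by blast
  obtain M where M: "\<And>k N. k \<ge> M \<Longrightarrow> vnorm {k<..N} y \<le> \<delta> / 2"
    using l2_tail_small[OF y, of "\<delta> / 2"] \<delta> by auto
  have "\<forall>\<^sub>F k in sequentially. l2norm (\<lambda>n. K (x (r k)) n - y n) < \<delta> / 2 \<and> k \<ge> M"
    using order_tendstoD(2)[OF lim, of "\<delta> / 2"] \<delta> by (intro eventually_conj eventually_ge_at_top) auto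
  then obtain k where k: "l2norm (\<lambda>n. K (x (r k)) n - y n) < \<delta> / 2" "k \<ge> M"
    unfolding eventually_sequentially by blast
  \<comment> \<open>A subsequence satisfies r k \<ge> k, so its offending tails also start beyond
    \<open>M\<close>.\<close>
  have rk: "r k \<ge> M" using k(2) seq_suble[OF r, of k] by simp
  let ?X = "{r k<..N (r k)}"
  have "vnorm ?X (K (x (r k))) = vnorm ?X (\<lambda>n. (K (x (r k)) n - y n) + y n)" by simp
  also have "\<dots> \<le> vnorm ?X (\<lambda>n. K (x (r k)) n - y n) + vnorm ?X y" by (rule vnorm_add_le)
  also have "vnorm ?X (\<lambda>n. K (x (r k)) n - y n) \<le> l2norm (\<lambda>n. K (x (r k)) n - y n)"
    by (intro vnorm_le_l2norm l2_diff bounded_op_l2[OF Kb] x y) auto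
  finally show False using k(1) M[OF rk, of "N (r k)"] xN[of "r k"] by linarith
qed

lemma compact_hankel_op:
  assumes h: "hform_le \<gamma> pos pos C" and tail: "\<And>\<delta>. \<delta> > 0 \<Longrightarrow> \<exists>k. hform_le \<gamma> pos {k<..} \<delta>"
  shows "compact_op (hankel_op \<gamma>)"
proof (rule compact_opI[OF bounded_hankel_op[OF h]])
  fix \<delta> :: real assume \<delta>: "\<delta> > 0"
  obtain k where k: "hform_le \<gamma> pos {k<..} \<delta>" using tail[OF \<delta>] by blast
  have "vnorm {k<..N} (hankel_op \<gamma> a) \<le> \<delta> * l2norm a" if "a \<in> l2" for a N
    by (rule hankel_op_vnorm_le[OF h k]) (use \<delta> that in auto)
  then show "\<exists>k. \<forall>a\<in>l2. \<forall>N. vnorm {k<..N} (hankel_op \<gamma> a) \<le> \<delta> * l2norm a" by blast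
qed

section \<open>Distance to the compact operators\<close>

text \<open>Keeps the set whose infimum is \<open>dist_compact\<close> nonempty.\<close>

lemma compact_op_zero: "compact_op (\<lambda>a n. 0)"
  unfolding compact_op_def bounded_op_def
proof (intro conjI allI impI)
  show "\<exists>(r :: nat \<Rightarrow> nat) y. strict_mono r \<and> y \<in> l2 \<and> (\<lambda>k. l2norm (\<lambda>n. 0 - y n)) \<longlonglongrightarrow> 0"
    by (rule exI[of _ id], rule exI[of _ "\<lambda>n. 0"]) (simp add: strict_mono_id zero_in_l2)
  show "\<exists>C. \<forall>a\<in>l2. l2norm (\<lambda>n. 0) \<le> C * l2norm a" by (rule exI[of _ 0]) simp
qed (auto simp: zero_in_l2)

lemma dist_compact_le:
  assumes T: "bounded_op T" and K: "compact_op K"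
  shows "dist_compact T \<le> op_norm (op_diff T K)"
  unfolding dist_compact_def
proof (rule cInf_lower)
  show "bdd_below {op_norm (op_diff T K) |K. compact_op K}"
    using op_norm_nonneg bounded_op_diff[OF T] by (intro bdd_belowI[of _ 0]) (auto simp: compact_op_def)
qed (use K in blast)

lemma dist_compact_nonneg:
  assumes T: "bounded_op T"
  shows "0 \<le> dist_compact T"
  unfolding dist_compact_def
proof (rule cInf_greatest)
  show "{op_norm (op_diff T K) |K. compact_op K} \<noteq> {}" using compact_op_zero by blast
qed (use op_norm_nonneg bounded_op_diff[OF T] in \<open>auto simp: compact_op_def\<close>)

lemma dist_compact_approx:
  assumes "\<delta> > 0"
  obtains K where "compact_op K" "op_norm (op_diff T K) < dist_compact T + \<delta>"
proof -
  have "{op_norm (op_diff T K) |K. compact_op K} \<noteq> {}" using compact_op_zero by blast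
  then show ?thesis
    using cInf_lessD[of "{op_norm (op_diff T K) |K. compact_op K}" "dist_compact T + \<delta>"] assms that
    by (auto simp: dist_compact_def)
qed

lemma hankel_op_finite_support:
  assumes h: "hform_le \<gamma> pos pos C" and X: "finite X" "X \<subseteq> pos" and m: "m > 0"
  shows "hankel_op \<gamma> (\<lambda>n. if n \<in> X then a n else 0) m = (\<Sum>n\<in>X. a n * \<gamma> (n * m))"
proof -
  let ?a = "\<lambda>n. if n \<in> X then a n else 0"
  obtain M where M: "X \<subseteq> {..<M}" using X finite_nat_iff_bounded by auto
  have "(\<Sum>n=1..N. ?a n * \<gamma> (n * m)) = (\<Sum>n\<in>X. a n * \<gamma> (n * m))" if N: "N \<ge> M" for N
  proof (intro sum.mono_neutral_cong_right)
    show "X \<subseteq> {1..N}" using X M N by (force simp: Suc_le_eq)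
  qed auto
  then have "(\<lambda>N. \<Sum>n=1..N. ?a n * \<gamma> (n * m)) \<longlonglongrightarrow> (\<Sum>n\<in>X. a n * \<gamma> (n * m))"
    by (intro tendsto_eventually) (auto simp: eventually_sequentially)
  then show ?thesis
    using hankel_op_LIMSEQ[OF h l2_finite_support(1)[OF X] m] LIMSEQ_unique by blast
qed

text \<open>Subtract a nearly optimal compact \<open>K\<close>: the difference has norm below the
  distance plus \<delta>/2, and far out the images under \<open>K\<close> contribute only another
  \<delta>/2. Cutting off columns alone thus brings the norm down to the distance.\<close>

lemma hankel_tail_dist_compact:
  assumes h: "hform_le \<alpha> pos pos C" and \<delta>: "\<delta> > 0"
  shows "\<exists>k. hform_le \<alpha> pos {k<..} (dist_compact (hankel_op \<alpha>) + \<delta>)"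
proof -
  let ?T = "hankel_op \<alpha>" and ?e = "dist_compact (hankel_op \<alpha>)"
  have T: "bounded_op ?T" by (rule bounded_hankel_op[OF h])
  obtain K where K: "compact_op K" "op_norm (op_diff ?T K) < ?e + \<delta> / 2"
    using dist_compact_approx[of "\<delta> / 2" ?T] \<delta> by auto
  have Kb: "bounded_op K" using K by (simp add: compact_op_def)
  obtain k where k: "\<And>a N. a \<in> l2 \<Longrightarrow> vnorm {k<..N} (K a) \<le> \<delta> / 2 * l2norm a"
    using compact_op_tail[OF K(1), of "\<delta> / 2"] \<delta> by auto
  have e0: "?e \<ge> 0" by (rule dist_compact_nonneg[OF T])
  have "hform_le \<alpha> pos {k<..} (?e + \<delta>)"
  proof (rule hform_leI)
    fix X Y and a b :: "nat \<Rightarrow> complex"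
    assume XY: "finite X" "finite Y" "X \<subseteq> pos" "Y \<subseteq> {k<..}"
    define a' where "a' = (\<lambda>n. if n \<in> X then a n else 0)"
    have a': "a' \<in> l2" "l2norm a' \<le> vnorm X a" unfolding a'_def by (rule l2_finite_support[OF XY(1,3)])+
    obtain N where N: "Y \<subseteq> {..<N}" using XY finite_nat_iff_bounded by auto
    have "hform \<alpha> X Y a b = (\<Sum>m\<in>Y. b m * (\<Sum>n\<in>X. a n * \<alpha> (n * m)))"
      unfolding hform_def by (subst sum.swap) (simp add: sum_distrib_left mult_ac)
    also have "\<dots> = (\<Sum>m\<in>Y. b m * ?T a' m)"
      unfolding a'_def using XY by (intro sum.cong refl arg_cong2[where f = "(*)"] hankel_op_finite_support[OF h, symmetric]) auto
    finally have "cmod (hform \<alpha> X Y a b) \<le> vnorm Y b * vnorm Y (?T a')"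
      using cauchy_schwarz_vnorm[of b "?T a'" Y] by simp
    also have "\<dots> \<le> vnorm Y b * ((?e + \<delta>) * vnorm X a)"
    proof (rule mult_left_mono)
      show "vnorm Y (?T a') \<le> (?e + \<delta>) * vnorm X a"
      proof -
      have "vnorm Y (?T a') = vnorm Y (\<lambda>n. op_diff ?T K a' n + K a' n)" by (simp add: op_diff_def)
      also have "\<dots> \<le> vnorm Y (op_diff ?T K a') + vnorm Y (K a')" by (rule vnorm_add_le)
      also have "vnorm Y (op_diff ?T K a') \<le> l2norm (op_diff ?T K a')"
        using XY by (intro vnorm_le_l2norm bounded_op_l2[OF bounded_op_diff[OF T Kb]] a')
      also have "\<dots> \<le> op_norm (op_diff ?T K) * l2norm a'"
        by (rule l2norm_le_op_norm[OF bounded_op_diff[OF T Kb] a'(1)])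
      also have "\<dots> \<le> (?e + \<delta> / 2) * l2norm a'"
        using K(2) l2norm_nonneg[OF a'(1)] by (intro mult_right_mono) auto
      also have "vnorm Y (K a') \<le> vnorm {k<..N} (K a')"
        using XY N by (intro vnorm_mono_set) force+
      also have "\<dots> \<le> \<delta> / 2 * l2norm a'" by (rule k[OF a'(1)])
      also have "(?e + \<delta> / 2) * l2norm a' + \<delta> / 2 * l2norm a' = (?e + \<delta>) * l2norm a'"
        by (simp add: algebra_simps)
      also have "\<dots> \<le> (?e + \<delta>) * vnorm X a" using a' e0 \<delta> by (intro mult_left_mono) auto
      finally show ?thesis by simp
      qed
    qed simp
    finally show "cmod (hform \<alpha> X Y a b) \<le> (?e + \<delta>) * vnorm X a * vnorm Y b"
      by (simp add: mult_ac)
  qed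
  then show ?thesis ..
qed

subsection \<open>Damped symbols\<close>

text \<open>The exponent r = 1/(k+1) runs to 0 as \<open>k\<close> grows. Since
  \<open>0 powr x = 0\<close>, the function is completely multiplicative at 0 as well.\<close>

definition damping :: "nat \<Rightarrow> nat \<Rightarrow> real"
  where "damping k n = real n powr - (1 / real (Suc k))"

lemma damping_mult: "damping k (n * m) = damping k n * damping k m"
  by (simp add: damping_def powr_mult)

lemma damping_bounds: "0 \<le> damping k n" "damping k n \<le> 1"
proof -
  show "0 \<le> damping k n" by (simp add: damping_def)
  show "damping k n \<le> 1"
  proof (cases "n = 0")
    case False
    then show ?thesis using powr_mono[of "- (1 / real (Suc k))" 0 "real n"] by (simp add: damping_def)
  qed (simp add: damping_def)
qed

lemma damping_mono: "k \<le> l \<Longrightarrow> n > 0 \<Longrightarrow> damping k n \<le> damping l n"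
  unfolding damping_def by (intro powr_mono) (auto simp: field_simps)

lemma damping_antimono: "0 < n \<Longrightarrow> n \<le> m \<Longrightarrow> damping k m \<le> damping k n"
  unfolding damping_def by (intro powr_mono2') auto

lemma damping_tendsto_0: "(\<lambda>n. damping k n) \<longlonglongrightarrow> 0"
  unfolding damping_def
  by (rule tendsto_neg_powr[OF _ filterlim_real_sequentially]) simp

lemma damping_tendsto_1: "n > 0 \<Longrightarrow> (\<lambda>k. damping k n) \<longlonglongrightarrow> 1"
proof -
  assume n: "n > 0"
  have "(\<lambda>k. real n powr - (1 / real (Suc k))) \<longlonglongrightarrow> real n powr - 0"
    by (intro tendsto_powr tendsto_minus tendsto_const LIMSEQ_Suc[OF lim_1_over_n]) (use n in auto)
  then show ?thesis using n by (simp add: damping_def)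
qed

text \<open>Multiplying the symbol by a completely multiplicative \<open>w\<close> conjugates the operator by the
  diagonal operator with entries \<open>w n\<close>.\<close>

lemma hform_le_multiplicative_weight:
  fixes w :: "nat \<Rightarrow> real"
  assumes h: "hform_le \<gamma> A B C" and C: "C \<ge> 0" and w: "\<And>n m. w (n * m) = w n * w m"
    and p: "\<And>n. n \<in> A \<Longrightarrow> \<bar>w n\<bar> \<le> p" "p \<ge> 0" and q: "\<And>n. n \<in> B \<Longrightarrow> \<bar>w n\<bar> \<le> q" "q \<ge> 0"
  shows "hform_le (\<lambda>n. \<gamma> n * w n) A B (C * p * q)"
proof (rule hform_leI)
  fix X Y and a b :: "nat \<Rightarrow> complex"
  assume XY: "finite X" "finite Y" "X \<subseteq> A" "Y \<subseteq> B"
  have scale: "vnorm Z (\<lambda>n. c n * w n) \<le> r * vnorm Z c" if "\<And>n. n \<in> Z \<Longrightarrow> \<bar>w n\<bar> \<le> r" "r \<ge> 0" for Z r and c :: "nat \<Rightarrow> complex"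
    unfolding L2_set_right_distrib[OF that(2)]
    by (rule L2_set_mono) (auto simp: norm_mult mult.commute intro!: mult_right_mono that)
  have "hform (\<lambda>n. \<gamma> n * w n) X Y a b = hform \<gamma> X Y (\<lambda>n. a n * w n) (\<lambda>n. b n * w n)"
    unfolding hform_def by (simp add: w mult_ac)
  also have "cmod \<dots> \<le> C * vnorm X (\<lambda>n. a n * w n) * vnorm Y (\<lambda>n. b n * w n)"
    by (rule hform_leD[OF h XY])
  also have "\<dots> \<le> C * (p * vnorm X a) * (q * vnorm Y b)"
    using XY C p q by (intro mult_mono mult_left_mono scale) auto
  finally show "cmod (hform (\<lambda>n. \<gamma> n * w n) X Y a b) \<le> C * p * q * vnorm X a * vnorm Y b"
    by (simp add: mult_ac)
qed

text \<open>The damping factors are at most 1 and decrease in \<open>n\<close>, so columns beyond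
  \<open>m\<close> gain the factor \<open>damping k m\<close>, which tends to 0 in \<open>m\<close>.
  This is what makes damped operators compact.\<close>

lemma hform_le_damped:
  assumes h: "hform_le \<alpha> pos pos C"
  shows "m > 0 \<Longrightarrow> hform_le (\<lambda>n. \<alpha> n * damping k n) pos {m<..} (C * damping k m)"
    and "hform_le (\<lambda>n. \<alpha> n * damping k n) pos pos C"
proof -
  have C: "C \<ge> 0" by (rule hform_le_nonneg[OF h])
  show "hform_le (\<lambda>n. \<alpha> n * damping k n) pos {m<..} (C * damping k m)" if "m > 0"
    using hform_le_multiplicative_weight[OF hform_le_subset[OF h order_refl, of "{m<..}"] C,
        where w = "damping k" and p = 1 and q = "damping k m"] damping_mult
      damping_bounds damping_antimono that by auto
  show "hform_le (\<lambda>n. \<alpha> n * damping k n) pos pos C"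
    using hform_le_multiplicative_weight[OF h C, where w = "damping k" and p = 1 and q = 1] damping_mult damping_bounds by auto
qed

text \<open>Triangle inequality: the weight \<open>1 - damping k n\<close> is not multiplicative, so
  it is split into its two terms. This is the source of the factor 2 in the choice of the
  weights.\<close>

lemma hform_le_undamped_part:
  assumes h: "hform_le \<alpha> pos pos C"
  shows "hform_le (\<lambda>n. \<alpha> n * (1 - damping k n)) pos pos (2 * C)"
proof -
  have "hform_le (\<lambda>n. \<alpha> n + (- 1) * (\<alpha> n * damping k n)) pos pos (C + cmod (- 1) * C)"
    by (intro hform_le_add hform_le_scale h hform_le_damped(2)[OF h])
  then show ?thesis by (simp add: algebra_simps)
qed

section \<open>Inductive construction of the convex combination\<close>

text \<open>Far out the damped part is negligible and only c \<alpha> remains, whose tail norm is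
  about c e. The tail norm therefore grows by c e, although the full norm of the added term is only
  known to be at most 2 c C.\<close>

lemma tail_norm_step:
  assumes h: "hform_le \<alpha> pos pos C" and c: "0 \<le> c" "c \<le> 1"
    and \<alpha>: "\<And>\<delta>. \<delta> > 0 \<Longrightarrow> \<exists>k. hform_le \<alpha> {k<..} {k<..} (e + \<delta>)"
    and \<sigma>: "\<And>\<delta>. \<delta> > 0 \<Longrightarrow> \<exists>k. hform_le \<sigma> {k<..} {k<..} (s + \<delta>)"
    and \<delta>: "\<delta> > 0"
  shows "\<exists>m. hform_le (\<lambda>n. \<sigma> n + of_real c * (\<alpha> n * (1 - damping k n))) {m<..} {m<..} (s + c * e + \<delta>)"
proof -
  have C: "C \<ge> 0" by (rule hform_le_nonneg[OF h])
  obtain k1 k2 where k1: "hform_le \<alpha> {k1<..} {k1<..} (e + \<delta> / 3)" and k2: "hform_le \<sigma> {k2<..} {k2<..} (s + \<delta> / 3)"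
    using \<alpha>[of "\<delta> / 3"] \<sigma>[of "\<delta> / 3"] \<delta> by auto
  have "(\<lambda>n. C * damping k n) \<longlonglongrightarrow> C * 0" by (intro tendsto_intros damping_tendsto_0)
  then have "\<forall>\<^sub>F n in sequentially. C * damping k n < \<delta> / 3 \<and> n > max k1 k2"
    using \<delta> by (intro eventually_conj eventually_gt_at_top order_tendstoD(2)) auto
  then obtain m where m: "C * damping k m < \<delta> / 3" "m > k1" "m > k2"
    unfolding eventually_sequentially by auto
  have "hform_le (\<lambda>n. \<alpha> n * damping k n) {m<..} {m<..} (\<delta> / 3)"
    by (rule hform_le_weaken[OF hform_le_subset[OF hform_le_damped(1)[OF h, where m = m]]]) (use m in auto)
  then have "hform_le (\<lambda>n. \<sigma> n + (of_real c * \<alpha> n + of_real (- c) * (\<alpha> n * damping k n))) {m<..} {m<..}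
      ((s + \<delta> / 3) + (cmod (of_real c) * (e + \<delta> / 3) + cmod (of_real (- c)) * (\<delta> / 3)))"
    by (intro hform_le_add hform_le_scale hform_le_subset[OF k1] hform_le_subset[OF k2]) (use m in auto)
  then have "hform_le (\<lambda>n. \<sigma> n + of_real c * (\<alpha> n * (1 - damping k n))) {m<..} {m<..}
      (s + \<delta> / 3 + (c * (e + \<delta> / 3) + c * (\<delta> / 3)))"
    using c by (simp add: algebra_simps)
  moreover have "s + \<delta> / 3 + (c * (e + \<delta> / 3) + c * (\<delta> / 3)) \<le> s + c * e + \<delta>"
    using c \<delta> mult_right_mono[of c 1 \<delta>] by (simp add: field_simps)
  ultimately show ?thesis using hform_le_weaken by blast
qed

text \<open>The key estimate, applied to an added term that tends strongly to 0 in \<open>k\<close>.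
  The assumption \<open>room\<close> keeps the second entry of the maximum below \<open>e\<close>,
  so the norm stays strictly below \<open>e\<close> for some \<open>k\<close> as large as
  desired.\<close>

lemma norm_step:
  assumes h: "hform_le \<alpha> pos pos C" and c: "0 \<le> c" "c \<le> 1"
    and d: "hform_le \<sigma> pos pos d" "d < e"
    and \<sigma>: "\<And>\<delta>. \<delta> > 0 \<Longrightarrow> \<exists>k. hform_le \<sigma> {k<..} {k<..} (s + \<delta>)"
    and room: "s + c * (2 * C) < e"
  shows "\<exists>k\<ge>N. \<exists>d'<e. hform_le (\<lambda>n. \<sigma> n + of_real c * (\<alpha> n * (1 - damping k n))) pos pos d'"
proof -
  define \<tau> where "\<tau> k n = of_real c * (\<alpha> n * (1 - damping k n))" for k n
  \<comment> \<open>Half of the gap to \<open>e\<close>, so that the new bound is again strict and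
    the step can be repeated.\<close>
  define g where "g = (e - max d (s + c * (2 * C))) / 2"
  have g: "g > 0" using d(2) room by (simp add: g_def)
  have \<tau>: "hform_le (\<tau> k) pos pos (c * (2 * C))" for k
    unfolding \<tau>_def using hform_le_scale[OF hform_le_undamped_part[OF h], of "of_real c" k] c by simp
  have dom: "cmod (\<tau> k n) \<le> cmod (\<alpha> n)" for k n
  proof -
    have "cmod (complex_of_real (1 - damping k n)) \<le> 1"
      using damping_bounds[of k n] unfolding norm_of_real by simp
    then have "cmod (\<alpha> n) * cmod (complex_of_real (1 - damping k n)) \<le> cmod (\<alpha> n)"
      by (rule mult_left_le) simp
    then have "c * (cmod (\<alpha> n) * cmod (complex_of_real (1 - damping k n))) \<le> 1 * cmod (\<alpha> n)"
      using c by (intro mult_mono) auto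
    then show ?thesis using c by (simp add: \<tau>_def norm_mult)
  qed
  have lim: "(\<lambda>k. \<tau> k n) \<longlonglongrightarrow> 0" if n: "n > 0" for n
  proof -
    have "(\<lambda>k. \<tau> k n) \<longlonglongrightarrow> of_real c * (\<alpha> n * of_real (1 - 1))"
      unfolding \<tau>_def by (intro tendsto_intros damping_tendsto_1 n)
    then show ?thesis by simp
  qed
  have "\<forall>\<^sub>F k in sequentially. hform_le (\<lambda>n. \<sigma> n + \<tau> k n) pos pos (max d (s + c * (2 * C)) + g)"
    by (rule perturbation_norm_le_max[OF d(1) \<sigma> \<tau> hform_le_head_vanishing[OF h dom lim] g])
  then have "\<forall>\<^sub>F k in sequentially. hform_le (\<lambda>n. \<sigma> n + \<tau> k n) pos pos (max d (s + c * (2 * C)) + g) \<and> k \<ge> N"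
    by (intro eventually_conj eventually_ge_at_top)
  then obtain k where k: "hform_le (\<lambda>n. \<sigma> n + \<tau> k n) pos pos (max d (s + c * (2 * C)) + g)" "k \<ge> N"
    unfolding eventually_sequentially by blast
  have "max d (s + c * (2 * C)) + g < e" using d(2) room unfolding g_def by argo
  then show ?thesis using k unfolding \<tau>_def by blast
qed

text \<open>\<open>g\<close> is an infinite convex combination of damping functions with indices at
  least \<open>N\<close>. The first property gives optimality, the last two give compactness, and
  the lower bound gives closeness of \<alpha> g to \<alpha>.\<close>

lemma exists_damping_average:
  assumes h: "hform_le \<alpha> pos pos C" and e: "e > 0"
    and \<alpha>: "\<And>\<delta>. \<delta> > 0 \<Longrightarrow> \<exists>k. hform_le \<alpha> {k<..} {k<..} (e + \<delta>)"
  obtains g :: "nat \<Rightarrow> real" where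
    "hform_le (\<lambda>n. \<alpha> n * (1 - g n)) pos pos e"
    "\<And>n. n > 0 \<Longrightarrow> damping N n \<le> g n" "\<And>n. g n \<le> 1"
    "\<And>m. m > 0 \<Longrightarrow> hform_le (\<lambda>n. \<alpha> n * g n) pos {m<..} (C * g m)"
    "g \<longlonglongrightarrow> 0"
proof -
  have C: "C \<ge> 0" by (rule hform_le_nonneg[OF h])
  \<comment> \<open>The bound 1/2 gives \<theta> < 1, and the quotient gives 2 \<theta> C < e; the
    summand 1 covers C = 0.\<close>
  define \<theta> where "\<theta> = min (1 / 2) (e / (2 * C + 1))"
  have \<theta>: "0 < \<theta>" "\<theta> < 1" using e C by (auto simp: \<theta>_def)
  have \<theta>C: "\<theta> * (2 * C) < e"
  proof -
    have "\<theta> * (2 * C) \<le> e / (2 * C + 1) * (2 * C)" using C by (intro mult_right_mono) (auto simp: \<theta>_def)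
    also have "\<dots> < e" using C e by (simp add: field_simps)
    finally show ?thesis .
  qed
  \<comment> \<open>Each weight is the fraction \<theta> of the weight still missing, which is
    \<open>(1 - \<theta>) ^ j\<close>. The room needed at stage \<open>j\<close> is thus the
    inequality 2 \<theta> C < e scaled by that factor.\<close>
  define c where "c j = \<theta> * (1 - \<theta>) ^ j" for j
  have c: "0 \<le> c j" "c j \<le> 1" for j
    using \<theta> by (auto simp: c_def intro!: mult_le_one power_le_one)
  have sums_c: "c sums 1"
    using sums_mult[OF geometric_sums[of "1 - \<theta>"], of \<theta>] \<theta> by (simp add: c_def[abs_def])
  \<comment> \<open>Invariant of the partial sums: the norm is strictly below \<open>e\<close>, and
    the tail norm is at most \<open>e\<close> times the weight used so far. The clause for j = 0
    fixes the start.\<close>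
  define P where "P j \<sigma> \<longleftrightarrow> (j = 0 \<longrightarrow> \<sigma> = (\<lambda>n. 0)) \<and> (\<exists>d<e. hform_le \<sigma> pos pos d) \<and>
      (\<forall>\<delta>>0. \<exists>k. hform_le \<sigma> {k<..} {k<..} ((1 - (1 - \<theta>) ^ j) * e + \<delta>))" for j \<sigma>
  have "\<exists>\<sigma>. \<forall>j. P j (\<sigma> j) \<and> (\<exists>k\<ge>N. \<sigma> (Suc j) = (\<lambda>n. \<sigma> j n + of_real (c j) * (\<alpha> n * (1 - damping k n))))"
  proof (rule dependent_nat_choice)
    have "hform_le (\<lambda>n. 0) A B \<delta>" if "\<delta> \<ge> 0" for A B \<delta>
      using that by (intro hform_leI) (simp add: hform_def)
    then have "P 0 (\<lambda>n. 0)" unfolding P_def using e by (auto intro!: exI[of _ 0])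
    then show "\<exists>\<sigma>. P 0 \<sigma>" by blast
  next
    fix \<sigma> j assume "P j \<sigma>"
    then obtain d where d: "hform_le \<sigma> pos pos d" "d < e"
      and \<sigma>: "\<And>\<delta>. \<delta> > 0 \<Longrightarrow> \<exists>k. hform_le \<sigma> {k<..} {k<..} ((1 - (1 - \<theta>) ^ j) * e + \<delta>)"
      unfolding P_def by blast
    have "(1 - \<theta>) ^ j * (\<theta> * (2 * C)) < (1 - \<theta>) ^ j * e"
      using \<theta> \<theta>C by (intro mult_strict_left_mono) auto
    then have room: "(1 - (1 - \<theta>) ^ j) * e + c j * (2 * C) < e" by (simp add: c_def algebra_simps)
    obtain k d' where k: "k \<ge> N" "d' < e"
        "hform_le (\<lambda>n. \<sigma> n + of_real (c j) * (\<alpha> n * (1 - damping k n))) pos pos d'"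
      using norm_step[OF h c d \<sigma> room, of N] by blast
    have eq: "(1 - (1 - \<theta>) ^ Suc j) * e = (1 - (1 - \<theta>) ^ j) * e + c j * e"
      by (simp add: c_def algebra_simps)
    have "P (Suc j) (\<lambda>n. \<sigma> n + of_real (c j) * (\<alpha> n * (1 - damping k n)))"
      unfolding P_def eq using tail_norm_step[OF h c \<alpha> \<sigma>] k(2,3) by blast
    then show "\<exists>\<sigma>'. P (Suc j) \<sigma>' \<and> (\<exists>k\<ge>N. \<sigma>' = (\<lambda>n. \<sigma> n + of_real (c j) * (\<alpha> n * (1 - damping k n))))"
      using k(1) by blast
  qed
  then obtain \<sigma> where P: "\<And>j. P j (\<sigma> j)"
    and "\<forall>j. \<exists>k\<ge>N. \<sigma> (Suc j) = (\<lambda>n. \<sigma> j n + of_real (c j) * (\<alpha> n * (1 - damping k n)))"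
    by blast
  then obtain kk where kk: "\<And>j. kk j \<ge> N"
    and step: "\<And>j. \<sigma> (Suc j) = (\<lambda>n. \<sigma> j n + of_real (c j) * (\<alpha> n * (1 - damping (kk j) n)))"
    by metis
  define g where "g n = (\<Sum>j. c j * damping (kk j) n)" for n
  have term_le: "norm (c j * damping (kk j) n) \<le> c j" for j n
    using c damping_bounds by (auto simp: abs_mult intro!: mult_left_le)
  have smb: "summable (\<lambda>j. c j * damping (kk j) n)" for n
    by (rule summable_comparison_test'[OF sums_summable[OF sums_c] term_le])
  have g: "(\<lambda>j. c j * damping (kk j) n) sums g n" for n
    unfolding g_def by (rule summable_sums[OF smb])
  have \<sigma>: "\<sigma> j n = \<alpha> n * of_real (\<Sum>i<j. c i - c i * damping (kk i) n)" for j n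
  proof (induction j)
    case 0
    then show ?case using P[of 0] by (simp add: P_def)
  next
    case (Suc j)
    then show ?case by (simp add: step algebra_simps)
  qed
  have lim: "(\<lambda>j. \<sigma> j n) \<longlonglongrightarrow> \<alpha> n * of_real (1 - g n)" for n
    unfolding \<sigma> by (intro tendsto_intros) (use sums_diff[OF sums_c g[of n]] in \<open>simp add: sums_def\<close>)
  have le: "hform_le (\<sigma> j) pos pos e" for j
    using P[of j] unfolding P_def by (meson hform_le_weaken less_imp_le)
  have 1: "hform_le (\<lambda>n. \<alpha> n * (1 - g n)) pos pos e"
    by (rule hform_le_limit[where \<gamma> = \<sigma>, OF le lim])
  have 2: "damping N n \<le> g n" if n: "n > 0" for n
  proof -
    have "(\<lambda>j. c j * damping N n) sums (1 * damping N n)" by (rule sums_mult2[OF sums_c])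
    \<comment> \<open>All indices are at least \<open>N\<close>, damping increases with the index,
      and the weights sum to 1.\<close>
    then have "1 * damping N n \<le> g n"
      by (rule sums_le[OF _ _ g, rotated]) (intro mult_left_mono damping_mono kk n c)
    then show ?thesis by simp
  qed
  have 3: "g n \<le> 1" for n
    by (rule sums_le[OF _ g sums_c]) (intro mult_left_le c damping_bounds)
  have 4: "hform_le (\<lambda>n. \<alpha> n * g n) pos {m<..} (C * g m)" if m: "m > 0" for m
  proof (rule hform_le_limit[where \<gamma> = "\<lambda>j n. \<alpha> n * of_real (\<Sum>i<j. c i * damping (kk i) n)"])
    \<comment> \<open>The damped summands contribute their tail bounds additively, and the partial
      sums of these stay below \<open>C * g m\<close>.\<close>
    have part: "hform_le (\<lambda>n. \<alpha> n * of_real (\<Sum>i<j. c i * damping (kk i) n)) pos {m<..} (C * (\<Sum>i<j. c i * damping (kk i) m))" for j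
    proof (induction j)
      case 0
      then show ?case by (intro hform_leI) (simp add: hform_def)
    next
      case (Suc j)
      from hform_le_add[OF Suc hform_le_scale[OF hform_le_damped(1)[OF h m, of "kk j"], of "of_real (c j)"]]
      show ?case using c(1)[of j] by (simp add: algebra_simps)
    qed
    show "hform_le (\<lambda>n. \<alpha> n * of_real (\<Sum>i<j. c i * damping (kk i) n)) pos {m<..} (C * g m)" for j
    proof (rule hform_le_weaken[OF part])
      have "(\<Sum>i<j. c i * damping (kk i) m) \<le> g m"
        unfolding g_def by (rule sum_le_suminf[OF smb]) (use c damping_bounds in auto)
      then show "C * (\<Sum>i<j. c i * damping (kk i) m) \<le> C * g m" using C by (rule mult_left_mono)
    qed
    show "(\<lambda>j. \<alpha> n * of_real (\<Sum>i<j. c i * damping (kk i) n)) \<longlonglongrightarrow> \<alpha> n * g n" for n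
      by (intro tendsto_intros) (use g[of n] in \<open>simp add: sums_def\<close>)
  qed
  have "(\<lambda>n. \<Sum>j. c j * damping (kk j) n) \<longlonglongrightarrow> (\<Sum>j. c j * 0)"
  \<comment> \<open>Every summand tends to 0 in \<open>n\<close>, and the weights are a summable
    majorant, so limit and series may be interchanged.\<close>
  proof (rule tannerys_theorem[THEN conjunct2, THEN conjunct2])
    show "(\<lambda>n. c j * damping (kk j) n) \<longlonglongrightarrow> c j * 0" for j
      by (intro tendsto_intros damping_tendsto_0)
    show "\<forall>\<^sub>F (j, n) in sequentially \<times>\<^sub>F sequentially. norm (c j * damping (kk j) n) \<le> c j"
      using term_le by (intro always_eventually) auto
    show "summable c" by (rule sums_summable[OF sums_c])
  qed simp
  then have 5: "g \<longlonglongrightarrow> 0" by (simp add: g_def[abs_def])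
  show ?thesis by (rule that[OF 1 2 3 4 5])
qed

section \<open>Best compact approximants and their non-uniqueness\<close>

lemma exists_best_compact_hankel:
  assumes h: "hform_le \<alpha> pos pos C" and nc: "\<not> compact_op (hankel_op \<alpha>)"
  obtains \<beta> where "hankel_bounded \<beta>" "compact_op (hankel_op \<beta>)"
    "op_norm (op_diff (hankel_op \<alpha>) (hankel_op \<beta>)) = dist_compact (hankel_op \<alpha>)"
    "\<And>n. n > 0 \<Longrightarrow> cmod (\<alpha> n - \<beta> n) \<le> cmod (\<alpha> n) * (1 - damping N n)"
proof -
  let ?e = "dist_compact (hankel_op \<alpha>)"
  have C: "C \<ge> 0" by (rule hform_le_nonneg[OF h])
  have T: "bounded_op (hankel_op \<alpha>)" by (rule bounded_hankel_op[OF h])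
  note tail = hankel_tail_dist_compact[OF h]
  \<comment> \<open>At distance 0 the tail estimate would make the column tails arbitrarily small,
    hence the operator compact.\<close>
  have e: "?e > 0"
  proof (rule ccontr)
    assume "\<not> ?thesis"
    then have "?e = 0" using dist_compact_nonneg[OF T] by simp
    then have "compact_op (hankel_op \<alpha>)" using tail by (intro compact_hankel_op[OF h]) auto
    then show False using nc by simp
  qed
  have "\<exists>k. hform_le \<alpha> {k<..} {k<..} (?e + \<delta>)" if \<delta>: "\<delta> > 0" for \<delta>
  proof -
    obtain k where "hform_le \<alpha> pos {k<..} (?e + \<delta>)" using tail[OF \<delta>] by blast
    then have "hform_le \<alpha> {k<..} {k<..} (?e + \<delta>)" by (rule hform_le_subset) auto
    then show ?thesis ..
  qed
  then obtain g :: "nat \<Rightarrow> real" where g: "hform_le (\<lambda>n. \<alpha> n * (1 - g n)) pos pos ?e"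
    "\<And>n. n > 0 \<Longrightarrow> damping N n \<le> g n" "\<And>n. g n \<le> 1"
    "\<And>m. m > 0 \<Longrightarrow> hform_le (\<lambda>n. \<alpha> n * g n) pos {m<..} (C * g m)" "g \<longlonglongrightarrow> 0"
    using exists_damping_average[OF h e, where N = N] by blast
  define \<beta> where "\<beta> n = \<alpha> n * g n" for n
  have diff: "(\<lambda>n. \<alpha> n - \<beta> n) = (\<lambda>n. \<alpha> n * (1 - g n))" by (simp add: \<beta>_def algebra_simps)
  \<comment> \<open>Write \<beta> = \<alpha> - \<alpha> (1 - g), where the second term has norm at
    most the distance.\<close>
  have \<beta>: "hform_le \<beta> pos pos (C + cmod (- 1) * ?e)"
    using hform_le_add[OF h hform_le_scale[OF g(1), of "- 1"]] by (simp add: \<beta>_def[abs_def] algebra_simps)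
  have comp: "compact_op (hankel_op \<beta>)"
  proof (rule compact_hankel_op[OF \<beta>])
    fix \<delta> :: real assume \<delta>: "\<delta> > 0"
    have "(\<lambda>n. C * g n) \<longlonglongrightarrow> C * 0" by (intro tendsto_intros g(5))
    then have "\<forall>\<^sub>F m in sequentially. C * g m < \<delta> \<and> m > 0"
      using \<delta> by (intro eventually_conj eventually_gt_at_top order_tendstoD(2)) auto
    then obtain m where "C * g m < \<delta>" "m > 0" unfolding eventually_sequentially by blast
    then have "hform_le \<beta> pos {m<..} \<delta>"
      using hform_le_weaken[OF g(4)] unfolding \<beta>_def by simp
    then show "\<exists>m. hform_le \<beta> pos {m<..} \<delta>" ..
  qed
  have ub: "op_norm (op_diff (hankel_op \<alpha>) (hankel_op \<beta>)) \<le> ?e"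
    using hankel_op_l2(2)[OF g(1)[folded diff]] e
    by (intro op_norm_le) (auto simp: op_diff_hankel[OF h \<beta>])
  have lb: "?e \<le> op_norm (op_diff (hankel_op \<alpha>) (hankel_op \<beta>))"
    by (rule dist_compact_le[OF T comp])
  have near: "cmod (\<alpha> n - \<beta> n) \<le> cmod (\<alpha> n) * (1 - damping N n)" if n: "n > 0" for n
  proof -
    have "\<alpha> n - \<beta> n = \<alpha> n * of_real (1 - g n)" by (simp add: \<beta>_def algebra_simps)
    then have "cmod (\<alpha> n - \<beta> n) = cmod (\<alpha> n) * (1 - g n)"
      using g(3)[of n] by (simp only: norm_mult norm_of_real)
    also have "\<dots> \<le> cmod (\<alpha> n) * (1 - damping N n)" using g(2)[OF n] by (intro mult_left_mono) auto
    finally show ?thesis .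
  qed
  have "hankel_bounded \<beta>" using \<beta> hankel_bounded_iff by blast
  then show ?thesis by (rule that[OF _ comp order_antisym[OF ub lb] near])
qed

text \<open>The operator evaluates the symbol only at products of positive integers, so agreement
  off the dummy index 0 suffices.\<close>

lemma hankel_op_cong:
  assumes "\<And>n. n > 0 \<Longrightarrow> \<alpha> n = \<beta> n"
  shows "hankel_op \<alpha> = hankel_op \<beta>"
  unfolding hankel_op_def using assms by (intro ext) auto

theorem theorem1:
  fixes \<alpha> :: "nat \<Rightarrow> complex"
  assumes "hankel_bounded \<alpha>"
  shows "(\<exists>\<beta>. hankel_bounded \<beta> \<and> compact_op (hankel_op \<beta>) \<and>
            op_norm (op_diff (hankel_op \<alpha>) (hankel_op \<beta>)) = dist_compact (hankel_op \<alpha>))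
       \<and> (\<not> compact_op (hankel_op \<alpha>) \<longrightarrow>
            (\<exists>\<beta>1 \<beta>2. hankel_bounded \<beta>1 \<and> compact_op (hankel_op \<beta>1) \<and>
               op_norm (op_diff (hankel_op \<alpha>) (hankel_op \<beta>1)) = dist_compact (hankel_op \<alpha>) \<and>
               hankel_bounded \<beta>2 \<and> compact_op (hankel_op \<beta>2) \<and>
               op_norm (op_diff (hankel_op \<alpha>) (hankel_op \<beta>2)) = dist_compact (hankel_op \<alpha>) \<and>
               (\<exists>a\<in>l2. hankel_op \<beta>1 a \<noteq> hankel_op \<beta>2 a)))"
proof (cases "compact_op (hankel_op \<alpha>)")
  case True
  obtain C where h: "hform_le \<alpha> pos pos C" using assms hankel_bounded_iff by blast
  have T: "bounded_op (hankel_op \<alpha>)" by (rule bounded_hankel_op[OF h])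
  \<comment> \<open>In the compact case \<alpha> itself is a minimizer, and the distance is
    0.\<close>
  have "op_norm (op_diff (hankel_op \<alpha>) (hankel_op \<alpha>)) \<le> 0"
    by (rule op_norm_le) (simp_all add: op_diff_def)
  then have "op_norm (op_diff (hankel_op \<alpha>) (hankel_op \<alpha>)) = dist_compact (hankel_op \<alpha>)"
    using dist_compact_le[OF T True] dist_compact_nonneg[OF T] by linarith
  then show ?thesis using True assms by blast
next
  case False
  obtain C where h: "hform_le \<alpha> pos pos C" using assms hankel_bounded_iff by blast
  obtain \<beta>1 where \<beta>1: "hankel_bounded \<beta>1" "compact_op (hankel_op \<beta>1)"
    "op_norm (op_diff (hankel_op \<alpha>) (hankel_op \<beta>1)) = dist_compact (hankel_op \<alpha>)"
    using exists_best_compact_hankel[OF h False, where N = 0] by blast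
  \<comment> \<open>If the symbols agreed at all positive indices, the operator of \<alpha> would be
    compact.\<close>
  have "\<exists>n>0. \<alpha> n \<noteq> \<beta>1 n" using \<beta>1(2) False hankel_op_cong[of \<alpha> \<beta>1] by metis
  then obtain n where n: "n > 0" "\<alpha> n \<noteq> \<beta>1 n" by blast
  have "(\<lambda>N. cmod (\<alpha> n) * (1 - damping N n)) \<longlonglongrightarrow> cmod (\<alpha> n) * (1 - 1)"
    by (intro tendsto_intros damping_tendsto_1 n)
  then have "\<forall>\<^sub>F N in sequentially. cmod (\<alpha> n) * (1 - damping N n) < cmod (\<alpha> n - \<beta>1 n)"
    using n(2) by (intro order_tendstoD(2)) auto
  \<comment> \<open>Damping this weak forces the second minimizer to be closer to \<alpha> at
    \<open>n\<close> than \<beta>1 is, so the two symbols differ there.\<close>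
  then obtain N where N: "cmod (\<alpha> n) * (1 - damping N n) < cmod (\<alpha> n - \<beta>1 n)"
    unfolding eventually_sequentially by blast
  obtain \<beta>2 where \<beta>2: "hankel_bounded \<beta>2" "compact_op (hankel_op \<beta>2)"
    "op_norm (op_diff (hankel_op \<alpha>) (hankel_op \<beta>2)) = dist_compact (hankel_op \<alpha>)"
    "\<And>n. n > 0 \<Longrightarrow> cmod (\<alpha> n - \<beta>2 n) \<le> cmod (\<alpha> n) * (1 - damping N n)"
    using exists_best_compact_hankel[OF h False, where N = N] by blast
  have ne: "\<beta>1 n \<noteq> \<beta>2 n" using N \<beta>2(4)[OF n(1)] by auto
  \<comment> \<open>The unit vector at 1 recovers the symbol: the coordinate \<open>n\<close> of its
    image is \<beta>(n). Different symbols therefore give different operators.\<close>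
  let ?u = "\<lambda>k. if k \<in> {1} then 1 else (0::complex)"
  have u: "?u \<in> l2" by (rule l2_finite_support(1)) auto
  have "hankel_op \<beta> ?u n = \<beta> n" if \<beta>: "hankel_bounded \<beta>" for \<beta>
  proof -
    obtain D where "hform_le \<beta> pos pos D" using \<beta> hankel_bounded_iff by blast
    then show ?thesis using hankel_op_finite_support[of \<beta> D "{1}" n "\<lambda>_. 1"] n(1) by simp
  qed
  then have "hankel_op \<beta>1 ?u \<noteq> hankel_op \<beta>2 ?u" using ne \<beta>1(1) \<beta>2(1) by metis
  then show ?thesis using \<beta>1 \<beta>2(1-3) u by blast
qed

end
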